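(* Let $p\ge1$ and let $\mathcal{P}_*$ be the set of probability measures $G$ on $\mathbb{R}^d\times S_d^{++}(\mathbb{R})$ such that $\int d((\mu,\Sigma),(\mu_0,\Sigma_0))^p\,dG(\mu,\Sigma)<\infty$ for every $(\mu_0,\Sigma_0)\in\mathbb{R}^d\times S_d^{++}(\mathbb{R})$, where $d((\mu_1,\Sigma_1),(\mu_2,\Sigma_2))=\sqrt{\|\mu_1-\mu_2\|_2^2+\|\log\Sigma_1-\log\Sigma_2\|_F^2}$. Then $\text{Mix-}SW_p(G_1,G_2):=\big(\text{Mix-}SW_p^p(G_1,G_2)\big)^{1/p}$ is a metric on $\mathcal{P}_*$: it is nonnegative, symmetric, satisfies the triangle inequality, and $\text{Mix-}SW_p(G_1,G_2)=0$ if and only if $G_1=G_2$.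
   Context: $S_d^{++}(\mathbb{R})$ is the set of $d\times d$ real symmetric positive definite matrices, $\log$ the matrix logarithm (via spectral decomposition). Let $\mathbb{S}=\{w\in\mathbb{R}^2:\|w\|_2=1\}$, $\mathbb{S}^{d-1}=\{v\in\mathbb{R}^d:\|v\|_2=1\}$, and let $\mathcal{U}(S_d(\mathbb{R}))$ denote the uniform distribution on the set of real symmetric $d\times d$ matrices $A$ with $\|A\|_F=1$. For $w=(w_1,w_2)\in\mathbb{S}$, $v\in\mathbb{S}^{d-1}$, and such $A$, set $V_w=(w_1v,w_2A)$ and $P_{V_w}(\mu,\Sigma)=w_1\langle\mu,v\rangle+w_2\,\mathrm{Trace}(A\log\Sigma)$. The Mixed Sliced Wasserstein distance is $$\text{Mix-}SW_p^p(G_1,G_2)=\mathbb{E}_{(w,v,A)\sim\mathcal{U}(\mathbb{S})\otimes\mathcal{U}(\mathbb{S}^{d-1})\otimes\mathcal{U}(S_d(\mathbb{R}))}\big[W_p^p(P_{V_w}\sharp G_1,P_{V_w}\sharp G_2)\big],$$ where $\sharp$ denotes push-forward and $W_p^p(\alpha,\beta)=\inf_{\pi\in\Pi(\alpha,\beta)}\int|x-y|^p\,d\pi(x,y)$ is the $p$-th power of the Wasserstein-$p$ distance between probability measures on $\mathbb{R}$, $\Pi(\alpha,\beta)$ being the set of couplings. *)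

theory Defs
  imports "HOL-Probability.Probability"
begin

definition SPD :: "(real^'d^'d) set" where
  "SPD = {S. transpose S = S \<and> (\<forall>x::real^'d. x \<noteq> 0 \<longrightarrow> x \<bullet> (S *v x) > 0)}"

definition diag_mat :: "real^'d \<Rightarrow> real^'d^'d" where
  "diag_mat v = (\<chi> i j. if i = j then v $ i else 0)"

definition mlog :: "real^'d^'d \<Rightarrow> real^'d^'d" where
  "mlog S = (if S \<in> SPD then
     (SOME L. \<exists>U lam. orthogonal_matrix U \<and> (\<forall>i. lam $ i > 0) \<and>
        S = U ** diag_mat lam ** transpose U \<and>
        L = U ** diag_mat (\<chi> i. ln (lam $ i)) ** transpose U)
   else 0)"

text \<open>Geodesic distance on R^d x S_d^{++}; norm on real^'d^'d is the Frobenius norm.\<close>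
definition gdist :: "((real^'d) \<times> (real^'d^'d)) \<Rightarrow> ((real^'d) \<times> (real^'d^'d)) \<Rightarrow> real" where
  "gdist x y = sqrt ((norm (fst x - fst y))\<^sup>2 + (norm (mlog (snd x) - mlog (snd y)))\<^sup>2)"

text \<open>Uniform distribution on the unit sphere of the range of an orthogonal projection P:
  push-forward of the uniform distribution on the unit ball under x |-> P x / |P x|.\<close>
definition unif_dir :: "('a::euclidean_space \<Rightarrow> 'b::real_normed_vector) \<Rightarrow> 'b measure" where
  "unif_dir P = distr (uniform_measure lborel (ball 0 1)) borel (\<lambda>x. sgn (P x))"

definition sym_part :: "real^'d^'d \<Rightarrow> real^'d^'d" where
  "sym_part M = (1/2) *\<^sub>R (M + transpose M)"

abbreviation unif_S1 :: "(real^2) measure" where "unif_S1 \<equiv> unif_dir (\<lambda>x::real^2. x)"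
abbreviation unif_Sd :: "(real^'d) measure" where "unif_Sd \<equiv> unif_dir (\<lambda>x::real^'d. x)"
abbreviation unif_SymS :: "(real^'d^'d) measure" where "unif_SymS \<equiv> unif_dir (sym_part :: real^'d^'d \<Rightarrow> _)"

definition couplings :: "real measure \<Rightarrow> real measure \<Rightarrow> (real \<times> real) measure set" where
  "couplings a b = {pi. sets pi = sets (borel :: (real \<times> real) measure) \<and>
      distr pi borel fst = a \<and> distr pi borel snd = b}"

definition wass_pp :: "real \<Rightarrow> real measure \<Rightarrow> real measure \<Rightarrow> ennreal" where
  "wass_pp p a b = (INF pi \<in> couplings a b. \<integral>\<^sup>+ z. ennreal (\<bar>fst z - snd z\<bar> powr p) \<partial>pi)"

definition proj_mix :: "real^2 \<Rightarrow> real^'d \<Rightarrow> real^'d^'d \<Rightarrow> ((real^'d) \<times> (real^'d^'d)) \<Rightarrow> real" where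
  "proj_mix w v A x = w $ 1 * (fst x \<bullet> v) + w $ 2 * trace (A ** mlog (snd x))"

definition mixSW_pp :: "real \<Rightarrow> ((real^'d) \<times> (real^'d^'d)) measure \<Rightarrow> ((real^'d) \<times> (real^'d^'d)) measure \<Rightarrow> ennreal" where
  "mixSW_pp p G1 G2 = (\<integral>\<^sup>+ z. wass_pp p (distr G1 borel (proj_mix (fst z) (fst (snd z)) (snd (snd z))))
                                         (distr G2 borel (proj_mix (fst z) (fst (snd z)) (snd (snd z))))
                       \<partial>(unif_S1 \<Otimes>\<^sub>M (unif_Sd \<Otimes>\<^sub>M (unif_SymS :: (real^'d^'d) measure))))"

definition mixSW :: "real \<Rightarrow> ((real^'d) \<times> (real^'d^'d)) measure \<Rightarrow> ((real^'d) \<times> (real^'d^'d)) measure \<Rightarrow> real" where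
  "mixSW p G1 G2 = (enn2real (mixSW_pp p G1 G2)) powr (1/p)"

definition Pstar :: "real \<Rightarrow> (((real^'d) \<times> (real^'d^'d)) measure) set" where
  "Pstar p = {G. sets G = sets (borel :: ((real^'d) \<times> (real^'d^'d)) measure) \<and> prob_space G \<and>
      (AE x in G. snd x \<in> SPD) \<and>
      (\<forall>x0. snd x0 \<in> SPD \<longrightarrow> (\<integral>\<^sup>+ x. ennreal (gdist x x0 powr p) \<partial>G) < \<infinity>)}"

end

theory Submission
  imports Defs
begin

text \<open>Write \<open>\<Phi>(\<mu>,\<Sigma>) = (\<mu>, log \<Sigma>)\<close>. Every projection \<open>P\<^sub>V\<close> is the inner product of \<open>\<Phi>\<close> with the direction
  \<open>\<theta> = (w\<^sub>1 v, w\<^sub>2 A)\<close>, so the distance is an \<open>L\<^sup>p\<close> average over \<open>\<theta>\<close> of one-dimensional Wasserstein distances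
  between slices of the image measures under \<open>\<Phi>\<close>. The triangle inequality is that of \<open>W\<^sub>p\<close> on the line followed by
  Minkowski; the integrand is measurable because it is Lipschitz in \<open>\<theta>\<close>. If the distance vanishes, almost
  all slices agree; the law of \<open>\<theta>\<close> charges every open set of unit directions, so by continuity the
  characteristic functions of the image measures agree everywhere. Hence so do the image measures, and
  \<open>G\<close> is recovered from its image because \<open>log\<close> has a Borel inverse.\<close>

section \<open>The spectral theorem and the matrix logarithm\<close>

text \<open>The integrand is an infimum over uncountably many couplings with values in
  \<open>ennreal\<close>, so neither its measurability nor its finiteness is evident, and both are
  at stake in the triangle inequality and in the zero case. One observation settles them: in
  direction 0 the slice of every probability measure is the Dirac measure at 0. Changing the
  direction within one measure costs at most the distance of the directions times a bound on the
  \<open>L^p\<close> norm, so slices of different measures are joined at finite cost through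
  direction 0, and their distance is Lipschitz in the direction. The moment is taken about
  \<open>(0, mat 1)\<close>, whose image under the logarithmic map is the origin. Equality of slices
  in direction \<theta> gives equal characteristic functions on the whole line through \<theta>.
  Since only symmetric \<open>A\<close> are drawn, these lines fill just the pairs with symmetric
  matrix part; a general argument reduces to that case because logarithms are symmetric and see only
  its symmetric part.\<close>

lemma symmetric_max_eigenvector:
  fixes f :: "'a::euclidean_space \<Rightarrow> 'a"
  assumes lin: "linear f" and sym: "\<And>x y. f x \<bullet> y = x \<bullet> f y"
    and V: "subspace V" and inv: "f ` V \<subseteq> V" and V0: "V \<noteq> {0}"
  obtains x c where "x \<in> V" "norm x = 1" "f x = c *\<^sub>R x"
proof -
  interpret linear f by fact
  let ?K = "V \<inter> sphere 0 1"
  have cf: "continuous_on A f" for A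
    using lin by (simp add: linear_continuous_on linear_conv_bounded_linear)
  have "compact ?K"
    using V by (intro closed_Int_compact closed_subspace) auto
  moreover obtain v where v: "v \<in> V" "v \<noteq> 0"
    using V0 subspace_0[OF V] by blast
  have "sgn v \<in> ?K"
    using v V by (simp add: sgn_div_norm subspace_scale)
  then have "?K \<noteq> {}" by blast
  moreover have "continuous_on ?K (\<lambda>x. x \<bullet> f x)"
    by (intro continuous_intros cf)
  ultimately obtain x where x: "x \<in> ?K" and mx: "\<And>y. y \<in> ?K \<Longrightarrow> y \<bullet> f y \<le> x \<bullet> f x"
    using continuous_attains_sup[of ?K "\<lambda>x. x \<bullet> f x"] by blast
  define c where "c = x \<bullet> f x"
  have nx: "x \<bullet> x = 1" using x by (simp add: norm_eq_sqrt_inner)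
  \<comment> \<open>Homogeneity turns maximality on the unit sphere into nonnegativity of this
    quadratic form on all of \<open>V\<close>.\<close>
  have q: "0 \<le> c * (z \<bullet> z) - z \<bullet> f z" if "z \<in> V" for z
  proof (cases "z = 0")
    case False
    then have "sgn z \<in> ?K" using that V by (simp add: sgn_div_norm subspace_scale)
    from mx[OF this] have "(z \<bullet> f z) / (norm z)\<^sup>2 \<le> c"
      by (simp add: c_def sgn_div_norm scaleR power2_eq_square field_simps)
    then show ?thesis using False by (simp add: field_simps power2_norm_eq_inner)
  qed (simp add: zero)
  define y where "y = c *\<^sub>R x - f x"
  have yV: "y \<in> V" unfolding y_def using x inv V by (intro subspace_diff subspace_scale) auto
  have "y \<bullet> y = 0"
  proof -
    \<comment> \<open>First variation at the maximiser: along \<open>x + t y\<close> the constant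
      term of the form vanishes, and its linear coefficient is \<open>2 (y \<bullet> y)\<close> by
      the choice of \<open>y\<close>. A nonnegative quadratic with zero constant term must have zero
      slope.\<close>
    have *: "0 \<le> 2 * t * (y \<bullet> y) + t\<^sup>2 * (c * (y \<bullet> y) - y \<bullet> f y)" for t
    proof -
      have xy: "x + t *\<^sub>R y \<in> V" using x yV V by (intro subspace_add subspace_scale) auto
      have "(c *\<^sub>R x - f x) \<bullet> y = c * (x \<bullet> y) - f x \<bullet> y" by (simp add: inner_diff_left)
      then have "y \<bullet> y = c * (x \<bullet> y) - f x \<bullet> y" by (simp only: y_def[symmetric])
      moreover have "c * ((x + t *\<^sub>R y) \<bullet> (x + t *\<^sub>R y)) - (x + t *\<^sub>R y) \<bullet> f (x + t *\<^sub>R y)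
        = (c * (x \<bullet> x) - c) + 2 * t * (c * (x \<bullet> y) - f x \<bullet> y) + t\<^sup>2 * (c * (y \<bullet> y) - y \<bullet> f y)"
        using sym[of x y] sym[of y x] c_def
        unfolding add scaleR
        by (simp add: inner_add_left inner_add_right inner_commute[of y x] inner_commute[of "f x"] inner_commute[of "f y"] algebra_simps power2_eq_square)
      ultimately show ?thesis using q[OF xy] nx by simp
    qed
    define a where "a = y \<bullet> y"
    define b where "b = c * (y \<bullet> y) - y \<bullet> f y"
    have b0: "0 \<le> b" unfolding b_def using q[OF yV] .
    have a0: "0 \<le> a" by (simp add: a_def)
    \<comment> \<open>At \<open>- t\<close> the quadratic equals \<open>- t^2 (b + 2)\<close>; the 1
      in the denominator keeps it nonzero when \<open>b = 0\<close>.\<close>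
    define t where "t = a / (b + 1)"
    have at: "a = t * (b + 1)" using b0 by (simp add: t_def)
    have "0 \<le> 2 * (- t) * a + (- t)\<^sup>2 * b"
      unfolding a_def b_def by (rule *)
    then have "t\<^sup>2 * (b + 2) \<le> 0"
      unfolding at by (simp add: algebra_simps power2_eq_square)
    then have "t = 0" using b0 by (smt (verit) mult_pos_pos zero_less_power2)
    then have "a = 0" by (simp add: at)
    then show ?thesis by (simp add: a_def)
  qed
  then have "f x = c *\<^sub>R x" by (simp add: y_def)
  then show thesis using that x by auto
qed

text \<open>By symmetry the orthogonal complement of an eigenvector inside \<open>V\<close> is again
  invariant and has smaller dimension, so eigenvectors are split off one at a time.\<close>

lemma symmetric_eigenbasis:
  fixes f :: "'a::euclidean_space \<Rightarrow> 'a"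
  assumes lin: "linear f" and sym: "\<And>x y. f x \<bullet> y = x \<bullet> f y"
  shows "subspace V \<Longrightarrow> f ` V \<subseteq> V \<Longrightarrow>
    \<exists>B \<subseteq> V. pairwise orthogonal B \<and> (\<forall>x\<in>B. norm x = 1 \<and> (\<exists>c. f x = c *\<^sub>R x)) \<and> V \<subseteq> span B"
proof (induction "dim V" arbitrary: V rule: less_induct)
  case less
  show ?case
  proof (cases "V = {0}")
    case True
    then show ?thesis by (intro exI[of _ "{}"]) auto
  next
    case False
    obtain x c where x: "x \<in> V" "norm x = 1" "f x = c *\<^sub>R x"
      using symmetric_max_eigenvector[OF lin sym less.prems False] by blast
    have xx: "x \<bullet> x = 1" using x by (simp add: norm_eq_sqrt_inner)
    define W where "W = V \<inter> {y. x \<bullet> y = 0}"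
    have W: "subspace W" unfolding W_def
      by (intro subspace_inter less.prems subspace_hyperplane)
    have "f ` W \<subseteq> W"
      using less.prems(2) x by (auto simp: W_def simp flip: sym)
    moreover have "dim W < dim V"
    proof -
      have "W \<subseteq> V" "x \<notin> W" using xx by (auto simp: W_def)
      then show ?thesis
        using x W less.prems(1) by (metis dim_subset order_le_imp_less_or_eq subspace_dim_equal order_refl)
    qed
    ultimately obtain B where B: "B \<subseteq> W" "pairwise orthogonal B"
        "\<forall>x\<in>B. norm x = 1 \<and> (\<exists>c. f x = c *\<^sub>R x)" "W \<subseteq> span B"
      using less.hyps[of W] W by blast
    show ?thesis
    proof (intro exI[of _ "insert x B"] conjI)
      show "insert x B \<subseteq> V" using B x by (auto simp: W_def)
      show "pairwise orthogonal (insert x B)"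
        using B by (auto simp: pairwise_insert W_def orthogonal_def inner_commute)
      show "\<forall>x\<in>insert x B. norm x = 1 \<and> (\<exists>c. f x = c *\<^sub>R x)" using B x by auto
      show "V \<subseteq> span (insert x B)"
      proof
        fix v assume v: "v \<in> V"
        have "v - (x \<bullet> v) *\<^sub>R x \<in> W"
          using v x xx less.prems(1)
          by (auto simp: W_def inner_diff_right intro: subspace_diff subspace_scale)
        then have "v - (x \<bullet> v) *\<^sub>R x \<in> span B" using B by blast
        then show "v \<in> span (insert x B)" by (auto simp: span_insert)
      qed
    qed
  qed
qed

lemma spec_nth:
  "(U ** diag_mat l ** transpose U) $ i $ j = (\<Sum>k\<in>UNIV. U $ i $ k * l $ k * U $ j $ k)"
  by (simp add: matrix_matrix_mult_def diag_mat_def transpose_def if_distrib if_distribR sum.delta cong: if_cong)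

text \<open>The columns of \<open>U\<close> are an orthonormal eigenbasis indexed by
  \<open>'d\<close>. The last conclusion presents each eigenvalue as a value of the quadratic form
  at a nonzero vector, which is how positive definiteness reaches the eigenvalues.\<close>

lemma symmetric_matrix_spectral:
  fixes S :: "real^'d^'d"
  assumes "transpose S = S"
  obtains U l where "orthogonal_matrix U" "S = U ** diag_mat l ** transpose U"
    "\<And>i. \<exists>x. x \<noteq> 0 \<and> l $ i = x \<bullet> (S *v x)"
proof -
  have sym: "(S *v x) \<bullet> y = x \<bullet> (S *v y)" for x y
    using dot_lmul_matrix[of x S y] assms by (metis transpose_matrix_vector)
  obtain B where B: "pairwise orthogonal B" "\<forall>x\<in>B. norm x = 1 \<and> (\<exists>c. S *v x = c *\<^sub>R x)"
      "span B = (UNIV :: (real^'d) set)"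
    using symmetric_eigenbasis[of "(*v) S" UNIV] sym matrix_vector_mul_linear[of S] by auto
  have "0 \<notin> B" using B by force
  then have "independent B" using B pairwise_orthogonal_independent by blast
  then have "card B = CARD('d)" "finite B"
    using B dim_eq_card[of B UNIV] by (auto simp: independent_imp_finite)
  then obtain g where g: "bij_betw g (UNIV :: 'd set) B"
    using finite_same_card_bij[of "UNIV :: 'd set" B] by auto
  then have gB: "g i \<in> B" for i by (auto simp: bij_betw_def)
  have gi: "g i \<bullet> g j = (if i = j then 1 else 0)" for i j
  proof (cases "i = j")
    case True
    then show ?thesis using B gB[of j] by (auto simp: norm_eq_sqrt_inner)
  next
    case False
    then have "g i \<noteq> g j" using g by (auto simp: bij_betw_def inj_def)
    then show ?thesis using False B gB by (auto simp: pairwise_def orthogonal_def)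
  qed
  have "\<exists>c. S *v g i = c *\<^sub>R g i" for i using B gB by blast
  then obtain l where l: "\<And>i. S *v g i = l i *\<^sub>R g i" by metis
  define U :: "real^'d^'d" where "U = (\<chi> i j. g j $ i)"
  have "(transpose U ** U) $ i $ j = g i \<bullet> g j" for i j
    by (simp add: U_def transpose_def matrix_matrix_mult_def inner_vec_def)
  then have UU: "transpose U ** U = mat 1" by (simp add: vec_eq_iff mat_def gi)
  then have UU': "U ** transpose U = mat 1" by (simp add: matrix_left_right_inverse)
  have SU: "S ** U = U ** diag_mat (\<chi> i. l i)"
  proof -
    have "(\<Sum>k\<in>UNIV. S $ i $ k * g j $ k) = l j * g j $ i" for i j
      using arg_cong[OF l[of j], of "\<lambda>v. v $ i"] by (simp add: matrix_vector_mult_def)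
    then show ?thesis
      by (simp add: vec_eq_iff U_def diag_mat_def matrix_matrix_mult_def if_distrib if_distribR sum.delta mult.commute cong: if_cong)
  qed
  show thesis
  proof (rule that[of U "\<chi> i. l i"])
    show "orthogonal_matrix U" using UU UU' by (simp add: orthogonal_matrix_def)
    show "S = U ** diag_mat (vec_lambda l) ** transpose U"
      by (metis SU UU' matrix_mul_assoc matrix_mul_rid)
    show "\<exists>x. x \<noteq> 0 \<and> vec_lambda l $ i = x \<bullet> (S *v x)" for i
      using gi[of i i] by (intro exI[of _ "g i"]) (auto simp: l)
  qed
qed

section \<open>Polynomials in a matrix, and Borel measurability of the logarithm and its
  inverse\<close>

fun mpow :: "real^'d^'d \<Rightarrow> nat \<Rightarrow> real^'d^'d" where
  "mpow A 0 = mat 1"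
| "mpow A (Suc n) = A ** mpow A n"

definition mpoly :: "(nat \<Rightarrow> real) \<Rightarrow> nat \<Rightarrow> real^'d^'d \<Rightarrow> real^'d^'d" where
  "mpoly a n A = (\<Sum>k\<le>n. a k *\<^sub>R mpow A k)"

lemma measurable_mpoly [measurable]: "mpoly a n \<in> borel_measurable borel"
proof -
  have "continuous_on UNIV (\<lambda>A. mpow A k)" for k
  proof (induction k)
    case (Suc k)
    then show ?case unfolding mpow.simps matrix_matrix_mult_def
      by (intro continuous_intros)
  qed simp
  then have "continuous_on UNIV (mpoly a n)"
    unfolding mpoly_def by (intro continuous_intros)
  then show ?thesis by (rule borel_measurable_continuous_onI)
qed

text \<open>The factors \<open>transpose U ** U\<close> between consecutive powers cancel, so a
  polynomial acts on the eigenvalues alone. Logarithm and exponential are both reached as limits of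
  such polynomials.\<close>

lemma mpoly_spec:
  assumes "orthogonal_matrix U"
  shows "mpoly a n (U ** diag_mat l ** transpose U) =
    U ** diag_mat (\<chi> i. \<Sum>k\<le>n. a k * (l $ i) ^ k) ** transpose U"
proof -
  have UU: "transpose U ** U = mat 1" and UU': "U ** transpose U = mat 1"
    using assms unfolding orthogonal_matrix_def by blast+
  have D: "diag_mat l ** diag_mat m = diag_mat (\<chi> i. l $ i * m $ i)" for l m :: "real^'d"
    by (simp add: vec_eq_iff diag_mat_def matrix_matrix_mult_def if_distrib[of "\<lambda>x. x * _"] sum.delta cong: if_cong)
  have D1: "diag_mat (\<chi> i. 1) = (mat 1 :: real^'d^'d)"
    by (simp add: vec_eq_iff diag_mat_def mat_def)
  have *: "mpow (U ** diag_mat l ** transpose U) k = U ** diag_mat (\<chi> i. (l $ i) ^ k) ** transpose U" for k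
  proof (induction k)
    case 0
    then show ?case by (simp add: D1 UU')
  next
    case (Suc k)
    have "mpow (U ** diag_mat l ** transpose U) (Suc k) =
      U ** diag_mat l ** (transpose U ** U) ** diag_mat (\<chi> i. (l $ i) ^ k) ** transpose U"
      by (simp only: mpow.simps Suc matrix_mul_assoc)
    also have "\<dots> = U ** (diag_mat l ** diag_mat (\<chi> i. (l $ i) ^ k)) ** transpose U"
      by (simp only: UU matrix_mul_rid matrix_mul_assoc)
    finally show ?case by (simp add: D)
  qed
  show ?thesis
    unfolding mpoly_def * vec_eq_iff
    apply (simp add: spec_nth sum_distrib_left sum_distrib_right)
    apply (subst sum.swap)
    apply (simp add: algebra_simps)
    done
qed

lemma spec_tendsto:
  assumes "\<And>i. (\<lambda>n. f n i) \<longlonglongrightarrow> g i"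
  shows "(\<lambda>n. U ** diag_mat (\<chi> i. f n i) ** transpose U) \<longlonglongrightarrow> U ** diag_mat (\<chi> i. g i) ** transpose U"
  by (intro vec_tendstoI) (auto simp: spec_nth intro!: tendsto_intros assms)

text \<open>Weierstrass approximation with error \<open>1/(n+1)\<close> on
  \<open>[1/(n+1), n+1]\<close>: the intervals exhaust the positive reals, so every fixed
  \<open>x\<close> is eventually covered.\<close>

lemma ln_polynomial_limit:
  obtains a :: "nat \<Rightarrow> nat \<Rightarrow> real" and m where
    "\<And>x. x > 0 \<Longrightarrow> (\<lambda>n. \<Sum>k\<le>m n. a n k * x ^ k) \<longlonglongrightarrow> ln x"
proof -
  have "\<exists>a m. \<forall>x \<in> {inverse (real (Suc n)) .. real (Suc n)}.
      \<bar>ln x - (\<Sum>k\<le>m. a k * x ^ k)\<bar> < inverse (real (Suc n))" for n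
  proof -
    have "continuous_on {inverse (real (Suc n)) .. real (Suc n)} ln"
      by (intro continuous_on_ln continuous_on_id) (auto simp: not_less[symmetric] dest: less_le_trans)
    then obtain g where g: "real_polynomial_function g"
        "\<And>x. x \<in> {inverse (real (Suc n)) .. real (Suc n)} \<Longrightarrow> \<bar>ln x - g x\<bar> < inverse (real (Suc n))"
      using Stone_Weierstrass_real_polynomial_function[of "{inverse (real (Suc n)) .. real (Suc n)}" ln "inverse (real (Suc n))"]
      by auto
    then show ?thesis using real_polynomial_function_iff_sum[of g] by blast
  qed
  then obtain a m where am: "\<And>n x. x \<in> {inverse (real (Suc n)) .. real (Suc n)} \<Longrightarrow>
      \<bar>ln x - (\<Sum>k\<le>m n. a n k * x ^ k)\<bar> < inverse (real (Suc n))" by metis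
  show thesis
  proof (rule that)
    fix x :: real assume "x > 0"
    have ev: "\<forall>\<^sub>F n in sequentially. inverse (real (Suc n)) < x"
      using LIMSEQ_inverse_real_of_nat \<open>x > 0\<close> by (rule order_tendstoD)
    have ev2: "\<forall>\<^sub>F n in sequentially. x \<le> real (Suc n)"
      using eventually_ge_at_top[of "nat \<lceil>x\<rceil>"] by eventually_elim linarith
    have "(\<lambda>n. (\<Sum>k\<le>m n. a n k * x ^ k) - ln x) \<longlonglongrightarrow> 0"
    proof (rule Lim_null_comparison[OF _ LIMSEQ_inverse_real_of_nat])
      show "\<forall>\<^sub>F n in sequentially. norm ((\<Sum>k\<le>m n. a n k * x ^ k) - ln x) \<le> inverse (real (Suc n))"
        using ev ev2
      proof eventually_elim
        case (elim n)
        then show ?case using am[of x n] by (simp add: abs_minus_commute)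
      qed
    qed
    then show "(\<lambda>n. \<Sum>k\<le>m n. a n k * x ^ k) \<longlonglongrightarrow> ln x" by (simp add: LIM_zero_iff)
  qed
qed

lemma SPD_spectral:
  assumes "S \<in> SPD"
  obtains U l where "orthogonal_matrix U" "\<forall>i. l $ i > 0" "S = U ** diag_mat l ** transpose U"
proof -
  have "transpose S = S" and pos: "\<And>x. x \<noteq> 0 \<Longrightarrow> x \<bullet> (S *v x) > 0"
    using assms by (auto simp: SPD_def)
  then obtain U l where "orthogonal_matrix U" "S = U ** diag_mat l ** transpose U"
    "\<And>i. \<exists>x. x \<noteq> 0 \<and> l $ i = x \<bullet> (S *v x)"
    using symmetric_matrix_spectral by blast
  with pos that show thesis by metis
qed

text \<open>Whatever \<open>L\<close> the choice operator picks, it comes with a decomposition of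
  \<open>S\<close>, so facts about \<open>mlog S\<close> can be proved from that very
  decomposition.\<close>

lemma mlog_spec:
  assumes "S \<in> SPD"
  obtains U l where "orthogonal_matrix U" "\<forall>i. l $ i > 0"
    "S = U ** diag_mat l ** transpose U" "mlog S = U ** diag_mat (\<chi> i. ln (l $ i)) ** transpose U"
proof -
  have "\<exists>L. \<exists>U lam. orthogonal_matrix U \<and> (\<forall>i. lam $ i > 0) \<and>
        S = U ** diag_mat lam ** transpose U \<and>
        L = U ** diag_mat (\<chi> i. ln (lam $ i)) ** transpose U"
    using SPD_spectral[OF assms] by metis
  from someI_ex[OF this] show thesis
    using that assms by (auto simp: mlog_def)
qed

lemma mlog_symmetric: "transpose (mlog S) = mlog S"
proof (cases "S \<in> SPD")
  case True
  then show ?thesis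
    by (rule mlog_spec) (simp add: vec_eq_iff spec_nth, simp add: transpose_def spec_nth mult_ac)
next
  case False
  then show ?thesis by (simp add: mlog_def transpose_def vec_eq_iff)
qed

text \<open>Polynomials converging pointwise to \<open>ln\<close> on the positive reals give Borel measurability of \<open>mlog\<close>
  without any continuity argument for the spectral decomposition.\<close>

lemma mlog_polynomial_limit:
  obtains a :: "nat \<Rightarrow> nat \<Rightarrow> real" and m where
    "\<And>S :: real^'d^'d. S \<in> SPD \<Longrightarrow> (\<lambda>n. mpoly (a n) (m n) S) \<longlonglongrightarrow> mlog S"
proof -
  obtain a m where am: "\<And>x::real. x > 0 \<Longrightarrow> (\<lambda>n. \<Sum>k\<le>m n. a n k * x ^ k) \<longlonglongrightarrow> ln x"
    using ln_polynomial_limit by blast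
  show thesis
  proof (rule that)
    fix S :: "real^'d^'d" assume "S \<in> SPD"
    then show "(\<lambda>n. mpoly (a n) (m n) S) \<longlonglongrightarrow> mlog S"
      by (rule mlog_spec) (simp add: mpoly_spec, intro spec_tendsto am, simp)
  qed
qed

text \<open>Strict positivity is an uncountable family of open conditions. Compactness of the sphere
  replaces it by a uniform bound \<open>1/(n+1)\<close> for some \<open>n\<close>, which gives a
  countable union of closed sets.\<close>

lemma SPD_borel: "(SPD :: (real^'d^'d) set) \<in> sets borel"
proof -
  let ?C = "\<lambda>n. {S :: real^'d^'d. \<forall>x\<in>sphere 0 1. inverse (real (Suc n)) \<le> x \<bullet> (S *v x)}"
  have "SPD = {S :: real^'d^'d. transpose S = S} \<inter> (\<Union>n. ?C n)"
  proof (intro equalityI subsetI)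
    fix S :: "real^'d^'d" assume S: "S \<in> SPD"
    have "continuous_on (sphere 0 1) (\<lambda>x. x \<bullet> (S *v x))"
      by (intro continuous_intros matrix_vector_mult_linear_continuous_on)
    moreover have "sphere 0 1 \<noteq> ({} :: (real^'d) set)" by simp
    ultimately obtain x where x: "x \<in> sphere 0 1" "\<And>y. y \<in> sphere 0 1 \<Longrightarrow> x \<bullet> (S *v x) \<le> y \<bullet> (S *v y)"
      using continuous_attains_inf[of "sphere 0 1" "\<lambda>x. x \<bullet> (S *v x)"] by auto
    have "x \<noteq> 0" using x by auto
    then have "0 < x \<bullet> (S *v x)" using S by (auto simp: SPD_def)
    then obtain n where "inverse (real (Suc n)) < x \<bullet> (S *v x)" using reals_Archimedean by blast
    then have "S \<in> ?C n" using x by force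
    then show "S \<in> {S. transpose S = S} \<inter> (\<Union>n. ?C n)" using S by (auto simp: SPD_def)
  next
    fix S :: "real^'d^'d" assume "S \<in> {S. transpose S = S} \<inter> (\<Union>n. ?C n)"
    then obtain n where S: "transpose S = S" "S \<in> ?C n" by blast
    have "0 < x \<bullet> (S *v x)" if "x \<noteq> 0" for x
    proof -
      have "sgn x \<in> sphere 0 1" using that by (simp add: norm_sgn)
      then have "inverse (real (Suc n)) \<le> sgn x \<bullet> (S *v sgn x)" using S by blast
      also have "\<dots> = (x \<bullet> (S *v x)) / (norm x)\<^sup>2"
        by (simp add: sgn_div_norm matrix_vector_mult_scaleR power2_eq_square field_simps)
      finally have "0 < (x \<bullet> (S *v x)) / (norm x)\<^sup>2"
        by (rule less_le_trans[rotated]) simp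
      then show ?thesis using that by (simp add: zero_less_divide_iff)
    qed
    with S show "S \<in> SPD" by (simp add: SPD_def)
  qed
  moreover have c1: "closed {S :: real^'d^'d. transpose S = S}"
    unfolding transpose_def by (intro closed_Collect_eq continuous_intros)
  moreover have c2: "closed (?C n)" for n
  proof -
    have "?C n = (\<Inter>x\<in>sphere 0 1. {S. inverse (real (Suc n)) \<le> x \<bullet> (S *v x)})" by auto
    moreover have "closed \<dots>"
      unfolding matrix_vector_mult_def
      by (intro closed_INT ballI closed_Collect_le continuous_intros)
    ultimately show ?thesis by (simp only:)
  qed
  have "{S :: real^'d^'d. transpose S = S} \<inter> (\<Union>n. ?C n) \<in> sets borel"
    using c1 c2 by (intro sets.Int sets.countable_UN) (auto intro!: borel_closed simp del: of_nat_Suc)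
  ultimately show ?thesis by simp
qed

lemma measurable_mlog [measurable]: "(mlog :: real^'d^'d \<Rightarrow> _) \<in> borel_measurable borel"
proof -
  note SPD_borel[measurable]
  obtain a m where am: "\<And>S :: real^'d^'d. S \<in> SPD \<Longrightarrow> (\<lambda>n. mpoly (a n) (m n) S) \<longlonglongrightarrow> mlog S"
    using mlog_polynomial_limit by blast
  show ?thesis
  proof (rule borel_measurable_LIMSEQ_metric)
    \<comment> \<open>The value 0 off \<open>SPD\<close> is the default built into
      \<open>mlog\<close>, so the convergence holds at every matrix.\<close>
    show "(\<lambda>S. if S \<in> SPD then mpoly (a n) (m n) S else 0) \<in> borel_measurable borel" for n
      by measurable
    show "(\<lambda>n. if S \<in> SPD then mpoly (a n) (m n) S else 0) \<longlonglongrightarrow> mlog S" for S :: "real^'d^'d"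
      using am by (auto simp: mlog_def)
  qed
qed

lemma mat_1_SPD: "mat 1 \<in> SPD"
  by (simp add: SPD_def)

text \<open>Makes \<open>(0, mat 1)\<close> the base point about which \<open>gdist\<close> is the
  Euclidean norm of \<open>log_embed\<close>. Conjugating the identity by \<open>U\<close> forces
  all eigenvalues to be 1.\<close>

lemma mlog_mat_1: "mlog (mat 1 :: real^'d^'d) = 0"
proof -
  obtain U l where U: "orthogonal_matrix U"
    "mat 1 = U ** diag_mat l ** transpose U"
    "mlog (mat 1 :: real^'d^'d) = U ** diag_mat (\<chi> i. ln (l $ i)) ** transpose U"
    using mlog_spec[OF mat_1_SPD] by blast
  have "transpose U ** (U ** diag_mat l ** transpose U) ** U = transpose U ** U"
    by (metis U(2) matrix_mul_rid)
  then have "diag_mat l = mat 1"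
    using U(1) unfolding orthogonal_matrix_def
    by (metis matrix_mul_assoc matrix_mul_lid matrix_mul_rid)
  then have "diag_mat l $ i $ i = 1" for i by (simp add: mat_def)
  then have "l $ i = 1" for i by (simp add: diag_mat_def)
  then show ?thesis by (simp add: U(3) vec_eq_iff spec_nth)
qed

text \<open>The exponential series. Since \<open>lim\<close> preserves Borel measurability even
  where a sequence diverges, convergence has to be checked only at logarithms.\<close>

definition mexp :: "real^'d^'d \<Rightarrow> real^'d^'d" where
  "mexp L = lim (\<lambda>n. mpoly (\<lambda>k. inverse (fact k)) n L)"

lemma measurable_mexp [measurable]: "mexp \<in> borel_measurable borel"
  unfolding mexp_def by measurable

lemma mexp_mlog:
  assumes "S \<in> SPD"
  shows "mexp (mlog S) = S"
proof -
  obtain U l where U: "orthogonal_matrix U" "\<forall>i. l $ i > 0"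
    "S = U ** diag_mat l ** transpose U" "mlog S = U ** diag_mat (\<chi> i. ln (l $ i)) ** transpose U"
    using mlog_spec[OF assms] by blast
  have lim: "(\<lambda>n. \<Sum>k\<le>n. inverse (fact k) * ln (l $ i) ^ k) \<longlonglongrightarrow> l $ i" for i
    using exp_converges[of "ln (l $ i)"] U(2) by (simp add: sums_def_le)
  have "(\<lambda>n. mpoly (\<lambda>k. inverse (fact k)) n (mlog S)) \<longlonglongrightarrow> S"
    using spec_tendsto[where g="\<lambda>i. l $ i" and U=U, OF lim] unfolding U(4) mpoly_spec[OF U(1)]
    by (simp flip: U(3))
  then show ?thesis by (simp add: mexp_def limI)
qed

section \<open>The Wasserstein distance on the real line\<close>

text \<open>Pointwise core of Minkowski: convexity of the \<open>p\<close>-th power applied to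
  \<open>u/a\<close> and \<open>v/b\<close> with weights \<open>a/(a+b)\<close> and
  \<open>b/(a+b)\<close>. Later \<open>a\<close> and \<open>b\<close> bound the two
  \<open>L^p\<close> norms.\<close>

lemma powr_add_le:
  fixes u v a b p :: real
  assumes "u \<ge> 0" "v \<ge> 0" "a > 0" "b > 0" "p \<ge> 1"
  shows "(u + v) powr p \<le> (a + b) powr (p - 1) * (a powr (1 - p) * u powr p + b powr (1 - p) * v powr p)"
proof -
  \<comment> \<open>When one summand is zero the other term suffices alone, because its factor
    \<open>((c + d)/c) powr (p - 1)\<close> is at least 1.\<close>
  have zero: "x powr p \<le> (c + d) powr (p - 1) * (c powr (1 - p) * x powr p)" if "c > 0" "d > 0" for x c d :: real
  proof -
    have "1 \<le> ((c + d) / c) powr (p - 1)"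
      using that assms by (intro ge_one_powr_ge_zero) auto
    also have "\<dots> = (c + d) powr (p - 1) * c powr (1 - p)"
      using that by (simp add: powr_divide powr_minus[of c "p - 1", simplified] field_simps)
    finally show ?thesis
      using mult_right_mono[of 1 "(c + d) powr (p - 1) * c powr (1 - p)" "x powr p"] by (simp add: mult_ac)
  qed
  consider "u = 0" | "v = 0" | "u > 0" "v > 0" using assms by linarith
  then show ?thesis
  proof cases
    case 1
    then show ?thesis using zero[of b a v] assms by (simp add: add.commute)
  next
    case 2
    then show ?thesis using zero[of a b u] assms by simp
  next
    case 3
    have ab: "a + b > 0" using assms by simp
    have eq: "(b / (a + b)) * (v / b) + (a / (a + b)) * (u / a) = (u + v) / (a + b)"
      using assms ab by (simp add: add_divide_distrib)
    have co: "1 - b / (a + b) = a / (a + b)" using ab by (simp add: field_simps)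
    have "((1 - b / (a + b)) *\<^sub>R (u / a) + (b / (a + b)) *\<^sub>R (v / b)) powr p
        \<le> (1 - b / (a + b)) * (u / a) powr p + (b / (a + b)) * (v / b) powr p"
      using 3 assms by (intro convex_onD[OF powr_convex]) auto
    then have "((u + v) / (a + b)) powr p \<le> (a / (a + b)) * (u / a) powr p + (b / (a + b)) * (v / b) powr p"
      unfolding co using eq by (simp add: add.commute)
    then have "(u + v) powr p \<le> (a + b) powr p * ((a / (a + b)) * (u / a) powr p + (b / (a + b)) * (v / b) powr p)"
      using 3 ab assms by (simp add: powr_divide pos_divide_le_eq mult.commute)
    also have "\<dots> = (a + b) powr p / (a + b) * (a / a powr p * u powr p + b / b powr p * v powr p)"
      using 3 ab assms by (simp add: powr_divide distrib_left mult_ac)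
    also have "\<dots> = (a + b) powr (p - 1) * (a powr (1 - p) * u powr p + b powr (1 - p) * v powr p)"
      using ab assms by (simp add: powr_diff)
    finally show ?thesis .
  qed
qed

text \<open>Formulated with positive upper bounds \<open>a\<close>, \<open>b\<close> in place of the
  norms: this permits division by them, and callers whose norm may be zero enlarge it by a small
  amount.\<close>

lemma nn_integral_Minkowski:
  fixes f g :: "'a \<Rightarrow> real"
  assumes [measurable]: "f \<in> borel_measurable M" "g \<in> borel_measurable M"
    and nn: "\<And>x. f x \<ge> 0" "\<And>x. g x \<ge> 0" and p: "p \<ge> 1" and ab: "a > 0" "b > 0"
    and f: "(\<integral>\<^sup>+x. ennreal (f x powr p) \<partial>M) \<le> ennreal (a powr p)"
    and g: "(\<integral>\<^sup>+x. ennreal (g x powr p) \<partial>M) \<le> ennreal (b powr p)"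
  shows "(\<integral>\<^sup>+x. ennreal ((f x + g x) powr p) \<partial>M) \<le> ennreal ((a + b) powr p)"
proof -
  let ?c = "(a + b) powr (p - 1)"
  have "(\<integral>\<^sup>+x. ennreal ((f x + g x) powr p) \<partial>M) \<le>
      (\<integral>\<^sup>+x. ennreal ?c * (ennreal (a powr (1 - p)) * ennreal (f x powr p) + ennreal (b powr (1 - p)) * ennreal (g x powr p)) \<partial>M)"
  proof (intro nn_integral_mono)
    fix x
    show "ennreal ((f x + g x) powr p) \<le>
        ennreal ?c * (ennreal (a powr (1 - p)) * ennreal (f x powr p) + ennreal (b powr (1 - p)) * ennreal (g x powr p))"
      using powr_add_le[OF nn(1)[of x] nn(2)[of x] ab p]
      by (simp flip: ennreal_mult ennreal_plus add: ennreal_leI)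
  qed
  also have "\<dots> = ennreal ?c * (ennreal (a powr (1 - p)) * (\<integral>\<^sup>+x. ennreal (f x powr p) \<partial>M) + ennreal (b powr (1 - p)) * (\<integral>\<^sup>+x. ennreal (g x powr p) \<partial>M))"
    by (simp add: nn_integral_cmult nn_integral_add)
  also have "\<dots> \<le> ennreal ?c * (ennreal (a powr (1 - p)) * ennreal (a powr p) + ennreal (b powr (1 - p)) * ennreal (b powr p))"
    using f g by (intro mult_left_mono add_mono) auto
  also have "\<dots> = ennreal (?c * (a powr (1 - p) * a powr p + b powr (1 - p) * b powr p))"
    by (simp flip: ennreal_mult ennreal_plus)
  \<comment> \<open>Each product \<open>a powr (1 - p) * a powr p\<close> collapses to
    \<open>a\<close>, so the bracket is \<open>a + b\<close>.\<close>
  also have "?c * (a powr (1 - p) * a powr p + b powr (1 - p) * b powr p) = (a + b) powr p"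
    using ab by (simp flip: powr_add) (simp add: powr_diff)
  finally show ?thesis .
qed

text \<open>Instead of disintegrating, two couplings are glued along a countable partition of the common marginal:
  conditionally on the cell, the two are independent. Where \<open>f x = g y\<close> has mass 0 the density is \<open>\<infinity>\<close>,
  but only on a null set.\<close>

definition glue :: "'a measure \<Rightarrow> 'b measure \<Rightarrow> ('a \<Rightarrow> 'k) \<Rightarrow> ('b \<Rightarrow> 'k) \<Rightarrow> ('a \<times> 'b) measure" where
  "glue M N f g = density (M \<Otimes>\<^sub>M N)
    (\<lambda>(x, y). if f x = g y then inverse (emeasure M (f -` {f x} \<inter> space M)) else 0)"

context
  fixes M :: "'a measure" and N :: "'b measure" and f :: "'a \<Rightarrow> 'k :: countable" and g :: "'b \<Rightarrow> 'k"
  assumes M: "prob_space M" and N: "prob_space N"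
    and [measurable]: "f \<in> measurable M (count_space UNIV)" "g \<in> measurable N (count_space UNIV)"
    and same: "\<And>k. emeasure M (f -` {k} \<inter> space M) = emeasure N (g -` {k} \<inter> space N)"
begin

interpretation M: prob_space M by (rule M)
interpretation N: prob_space N by (rule N)
interpretation pair_sigma_finite M N ..

text \<open>There are only countably many level sets, so the null ones have null union. Elsewhere
  the mass and its inverse multiply to 1.\<close>

lemma AE_level_set_pos: "AE x in M. emeasure M (f -` {f x} \<inter> space M) \<noteq> 0"
proof -
  have "AE x in M. \<forall>k. emeasure M (f -` {k} \<inter> space M) = 0 \<longrightarrow> f x \<noteq> k"
  proof (subst AE_all_countable, intro allI)
    fix k
    show "AE x in M. emeasure M (f -` {k} \<inter> space M) = 0 \<longrightarrow> f x \<noteq> k"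
    proof (cases "emeasure M (f -` {k} \<inter> space M) = 0")
      case True
      then have "f -` {k} \<inter> space M \<in> null_sets M" by (intro null_setsI) auto
      then show ?thesis by (rule AE_I') blast
    qed auto
  qed
  then show ?thesis by eventually_elim auto
qed

text \<open>Integrating out the second variable leaves the \<open>N\<close>-mass of the cell of
  \<open>f x\<close>; by \<open>same\<close> this is its \<open>M\<close>-mass, which the density
  cancels.\<close>

lemma distr_glue_fst: "distr (glue M N f g) M fst = M"
proof (rule measure_eqI)
  fix A assume "A \<in> sets (distr (glue M N f g) M fst)"
  then have [measurable]: "A \<in> sets M" by simp
  let ?r = "\<lambda>k. emeasure M (f -` {k} \<inter> space M)"
  have "emeasure (distr (glue M N f g) M fst) A = (\<integral>\<^sup>+ z. indicator A (fst z) \<partial>glue M N f g)"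
    by (subst nn_integral_distr[where f = "indicator A", symmetric]) (auto simp: glue_def)
  also have "\<dots> = (\<integral>\<^sup>+ z. (if f (fst z) = g (snd z) then inverse (?r (f (fst z))) else 0) * indicator A (fst z) \<partial>(M \<Otimes>\<^sub>M N))"
    by (simp add: glue_def nn_integral_density split_beta')
  also have "\<dots> = (\<integral>\<^sup>+ x. \<integral>\<^sup>+ y. (if f x = g y then inverse (?r (f x)) else 0) * indicator A x \<partial>N \<partial>M)"
    by (subst N.nn_integral_fst[symmetric]) (auto cong: if_cong)
  also have "\<dots> = (\<integral>\<^sup>+ x. (inverse (?r (f x)) * indicator A x) * ?r (f x) \<partial>M)"
  proof (rule nn_integral_cong)
    fix x
    have "(\<integral>\<^sup>+ y. (if f x = g y then inverse (?r (f x)) else 0) * indicator A x \<partial>N) =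
        (\<integral>\<^sup>+ y. (inverse (?r (f x)) * indicator A x) * indicator (g -` {f x} \<inter> space N) y \<partial>N)"
      by (intro nn_integral_cong) (auto simp: indicator_def)
    then show "(\<integral>\<^sup>+ y. (if f x = g y then inverse (?r (f x)) else 0) * indicator A x \<partial>N) =
        (inverse (?r (f x)) * indicator A x) * ?r (f x)"
      by (simp add: nn_integral_cmult_indicator same)
  qed
  also have "\<dots> = (\<integral>\<^sup>+ x. indicator A x \<partial>M)"
  proof (rule nn_integral_cong_AE)
    show "AE x in M. (inverse (?r (f x)) * indicator A x) * ?r (f x) = indicator A x"
      using AE_level_set_pos
    proof eventually_elim
      case (elim x)
      moreover have "?r (f x) \<noteq> top" by simp
      ultimately have "inverse (?r (f x)) * ?r (f x) = 1"
        by (cases "?r (f x)" rule: ennreal_cases) (auto simp: inverse_ennreal simp flip: ennreal_mult)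
      then show ?case by (auto simp: indicator_def)
    qed
  qed
  finally show "emeasure (distr (glue M N f g) M fst) A = emeasure M A" by simp
qed simp

text \<open>The density divides by a mass of \<open>M\<close>, but \<open>same\<close> makes it the
  corresponding mass of \<open>N\<close>, so the construction is symmetric and the second marginal
  reduces to the first.\<close>

lemma glue_swap: "glue M N f g = distr (glue N M g f) (M \<Otimes>\<^sub>M N) (\<lambda>(x, y). (y, x))"
  unfolding glue_def
  by (subst (1) distr_pair_swap, subst density_distr)
    (auto simp: same intro!: arg_cong[where f = "\<lambda>M. distr M _ _"] density_cong)

lemma AE_glue: "AE z in glue M N f g. f (fst z) = g (snd z)"
  unfolding glue_def by (subst AE_density) (auto simp: split_beta')

end

text \<open>Placed after the context because the first-marginal lemma is applied with
  \<open>M\<close> and \<open>N\<close> exchanged.\<close>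

lemma distr_glue_snd:
  assumes "prob_space M" "prob_space N"
    and [measurable]: "f \<in> measurable M (count_space UNIV)" "g \<in> measurable N (count_space (UNIV :: 'k :: countable set))"
    and "\<And>k. emeasure M (f -` {k} \<inter> space M) = emeasure N (g -` {k} \<inter> space N)"
  shows "distr (glue M N f g) N snd = N"
proof -
  have s: "sets (glue N M g f) = sets (N \<Otimes>\<^sub>M M)" by (simp add: glue_def)
  have "distr (glue M N f g) N snd = distr (glue N M g f) N (snd \<circ> (\<lambda>(x, y). (y, x)))"
    unfolding glue_swap[OF assms]
    by (rule distr_distr) (simp_all add: measurable_cong_sets[OF s refl])
  also have "snd \<circ> (\<lambda>(x, y). (y, x)) = fst" by auto
  also have "distr (glue N M g f) N fst = N"
    by (rule distr_glue_fst) (use assms in auto)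
  finally show ?thesis .
qed

section \<open>Couplings, approximate gluing and the triangle inequality on the line\<close>

lemma couplings_sets:
  assumes "mu \<in> couplings a b"
  shows "sets mu = sets (borel \<Otimes>\<^sub>M borel)"
  using assms unfolding borel_prod by (simp add: couplings_def)

lemma coupling_prob:
  assumes "mu \<in> couplings a b" "prob_space a"
  shows "prob_space mu"
proof -
  note [measurable_cong] = couplings_sets[OF assms(1)]
  have "distr mu borel fst = a" using assms by (auto simp: couplings_def)
  then show ?thesis using assms(2) by (intro prob_space_distrD[of fst mu borel]) auto
qed

lemma couplings_swap:
  assumes "mu \<in> couplings a b"
  shows "distr mu borel (\<lambda>z. (snd z, fst z)) \<in> couplings b a"
proof -
  note [measurable_cong] = couplings_sets[OF assms]
  show ?thesis
    using assms by (simp add: couplings_def distr_distr comp_def flip: borel_prod)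
qed

lemma wass_pp_le:
  assumes "mu \<in> couplings a b"
  shows "wass_pp p a b \<le> (\<integral>\<^sup>+ z. ennreal (\<bar>fst z - snd z\<bar> powr p) \<partial>mu)"
  unfolding wass_pp_def using assms by (rule INF_lower)

lemma wass_pp_commute: "wass_pp p a b = wass_pp p b a"
proof -
  have "wass_pp p b a \<le> wass_pp p a b" for a b
    unfolding wass_pp_def[of p a b]
  proof (rule INF_greatest)
    fix mu assume mu: "mu \<in> couplings a b"
    note [measurable_cong] = couplings_sets[OF mu]
    have "wass_pp p b a \<le> (\<integral>\<^sup>+ z. ennreal (\<bar>fst z - snd z\<bar> powr p) \<partial>distr mu borel (\<lambda>z. (snd z, fst z)))"
      by (intro wass_pp_le couplings_swap mu)
    also have "\<dots> = (\<integral>\<^sup>+ z. ennreal (\<bar>fst z - snd z\<bar> powr p) \<partial>mu)"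
      by (subst nn_integral_distr) (auto simp: abs_minus_commute simp flip: borel_prod)
    finally show "wass_pp p b a \<le> \<dots>" .
  qed
  then show ?thesis by (simp add: antisym)
qed

text \<open>The cells are the intervals of length \<open>e\<close> picked out by
  \<open>\<lfloor>t / e\<rfloor>\<close>. They have equal mass on both sides since both middle
  marginals are \<open>b\<close>, and two values in one cell differ by at most \<open>e\<close>.
  This error is sent to 0 in the triangle inequality.\<close>

lemma approximate_gluing:
  assumes mu: "mu \<in> couplings a b" and nu: "nu \<in> couplings b c"
    and b: "prob_space b" and e: "e > 0"
  obtains gam :: "((real \<times> real) \<times> (real \<times> real)) measure" where
    "sets gam = sets borel" "prob_space gam" "distr gam borel fst = mu" "distr gam borel snd = nu"
    "AE z in gam. \<bar>snd (fst z) - fst (snd z)\<bar> \<le> e"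
proof -
  note [measurable_cong] = couplings_sets[OF mu] couplings_sets[OF nu]
  have sp: "sets mu = sets (borel :: (real \<times> real) measure)"
    and sr: "sets nu = sets (borel :: (real \<times> real) measure)"
    and d: "distr mu borel snd = b" "distr nu borel fst = b"
    using mu nu by (auto simp: couplings_def)
  have sb: "sets b = sets borel" using d by auto
  have P: "prob_space nu" using coupling_prob[OF nu b] .
  have Q: "prob_space mu" using b d(1) by (intro prob_space_distrD[of snd mu borel]) auto
  define f where "f z = \<lfloor>snd z / e\<rfloor>" for z :: "real \<times> real"
  define g where "g z = \<lfloor>fst z / e\<rfloor>" for z :: "real \<times> real"
  have fg [measurable]: "f \<in> measurable mu (count_space UNIV)" "g \<in> measurable nu (count_space UNIV)"
    unfolding f_def g_def by measurable
  have same: "emeasure mu (f -` {k} \<inter> space mu) = emeasure nu (g -` {k} \<inter> space nu)" for k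
  proof -
    have "emeasure mu (f -` {k} \<inter> space mu) = emeasure (distr mu borel snd) {t. \<lfloor>t / e\<rfloor> = k}"
      by (subst emeasure_distr) (auto simp: f_def vimage_def)
    also have "\<dots> = emeasure (distr nu borel fst) {t. \<lfloor>t / e\<rfloor> = k}" using d by simp
    also have "\<dots> = emeasure nu (g -` {k} \<inter> space nu)"
      by (subst emeasure_distr) (auto simp: g_def vimage_def)
    finally show ?thesis .
  qed
  let ?G = "glue mu nu f g"
  have sG: "sets ?G = sets (mu \<Otimes>\<^sub>M nu)" by (simp add: glue_def)
  have sG': "sets ?G = sets borel"
    unfolding sG borel_prod[symmetric]
    by (rule sets_pair_measure_cong[OF couplings_sets[OF mu] couplings_sets[OF nu]])
  show thesis
  proof (rule that[of ?G])
    show 1: "distr ?G borel fst = mu"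
      using distr_glue_fst[OF Q P fg same] distr_cong[OF refl sp, of ?G fst fst] by simp
    show "distr ?G borel snd = nu"
      using distr_glue_snd[OF Q P fg same] distr_cong[OF refl sr, of ?G snd snd] by simp
    show "prob_space ?G"
      using Q 1 by (intro prob_space_distrD[of fst ?G borel]) (auto simp: measurable_cong_sets[OF sG refl] measurable_cong_sets[OF sp refl] measurable_cong_sets[OF refl sp, symmetric])
    show "AE z in ?G. \<bar>snd (fst z) - fst (snd z)\<bar> \<le> e"
      using AE_glue[OF Q P fg same]
    proof eventually_elim
      case (elim z)
      then have "\<lfloor>snd (fst z) / e\<rfloor> = \<lfloor>fst (snd z) / e\<rfloor>" by (simp add: f_def g_def)
      then have "\<bar>snd (fst z) / e - fst (snd z) / e\<bar> \<le> 1" by linarith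
      then show ?case using e by (simp add: field_simps flip: diff_divide_distrib)
    qed
  qed (rule sG')
qed

text \<open>The strict bounds supply couplings of cost below \<open>A powr p\<close> and
  \<open>B powr p\<close>, so no optimal coupling has to exist. The outer coordinates of the glued
  measure couple \<open>a\<close> with \<open>c\<close>, and Minkowski is applied twice, with the
  gluing error as a third summand.\<close>

lemma wass_pp_triangle_less:
  assumes p: "p \<ge> 1" and b: "prob_space b" and AB: "A > 0" "B > 0" and e: "e > 0"
    and 1: "wass_pp p a b < ennreal (A powr p)" and 2: "wass_pp p b c < ennreal (B powr p)"
  shows "wass_pp p a c \<le> ennreal ((A + e + B) powr p)"
proof -
  obtain mu where mu: "mu \<in> couplings a b" "(\<integral>\<^sup>+ z. ennreal (\<bar>fst z - snd z\<bar> powr p) \<partial>mu) < ennreal (A powr p)"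
    using 1 unfolding wass_pp_def INF_less_iff by blast
  obtain nu where nu: "nu \<in> couplings b c" "(\<integral>\<^sup>+ z. ennreal (\<bar>fst z - snd z\<bar> powr p) \<partial>nu) < ennreal (B powr p)"
    using 2 unfolding wass_pp_def INF_less_iff by blast
  obtain G where G: "sets G = sets borel" "prob_space G" "distr G borel fst = mu" "distr G borel snd = nu"
    "AE z in G. \<bar>snd (fst z) - fst (snd z)\<bar> \<le> e"
    using approximate_gluing[OF mu(1) nu(1) b e] by blast
  interpret G: prob_space G by fact
  have [measurable_cong]: "sets G = sets ((borel \<Otimes>\<^sub>M borel) \<Otimes>\<^sub>M (borel \<Otimes>\<^sub>M borel))"
    using G(1) by (simp only: borel_prod)
  have fs: "fst \<in> measurable G borel" "snd \<in> measurable G borel"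
    unfolding borel_prod[symmetric] by measurable
  have cm: "(\<lambda>z :: real \<times> real. ennreal (\<bar>fst z - snd z\<bar> powr p)) \<in> borel_measurable borel"
    unfolding borel_prod[symmetric] by measurable
  let ?rho = "distr G borel (\<lambda>z. (fst (fst z), snd (snd z)))"
  have pm: "(\<lambda>z. (fst (fst z), snd (snd z))) \<in> measurable G borel"
    unfolding borel_prod[symmetric] by measurable
  have bm: "fst \<in> measurable (borel :: (real \<times> real) measure) borel"
      "snd \<in> measurable (borel :: (real \<times> real) measure) borel"
    unfolding borel_prod[symmetric] by measurable
  have "distr ?rho borel fst = a"
  proof -
    have "distr ?rho borel fst = distr (distr G borel fst) borel fst"
      using pm fs bm by (simp add: distr_distr comp_def)
    then show ?thesis using mu(1) G(3) by (simp add: couplings_def)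
  qed
  moreover have "distr ?rho borel snd = c"
  proof -
    have "distr ?rho borel snd = distr (distr G borel snd) borel snd"
      using pm fs bm by (simp add: distr_distr comp_def)
    then show ?thesis using nu(1) G(4) by (simp add: couplings_def)
  qed
  ultimately have "?rho \<in> couplings a c" by (simp add: couplings_def)
  then have "wass_pp p a c \<le> (\<integral>\<^sup>+ z. ennreal (\<bar>fst z - snd z\<bar> powr p) \<partial>?rho)"
    by (rule wass_pp_le)
  also have "\<dots> = (\<integral>\<^sup>+ z. ennreal (\<bar>fst (fst z) - snd (snd z)\<bar> powr p) \<partial>G)"
    by (subst nn_integral_distr[OF pm]) (simp_all add: cm)
  also have "\<dots> \<le> (\<integral>\<^sup>+ z. ennreal ((\<bar>fst (fst z) - snd (fst z)\<bar> + e + \<bar>fst (snd z) - snd (snd z)\<bar>) powr p) \<partial>G)"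
  proof (intro nn_integral_mono_AE)
    show "AE z in G. ennreal (\<bar>fst (fst z) - snd (snd z)\<bar> powr p) \<le>
        ennreal ((\<bar>fst (fst z) - snd (fst z)\<bar> + e + \<bar>fst (snd z) - snd (snd z)\<bar>) powr p)"
      using G(5)
    proof eventually_elim
      case (elim z)
      then have "\<bar>fst (fst z) - snd (snd z)\<bar> \<le> \<bar>fst (fst z) - snd (fst z)\<bar> + e + \<bar>fst (snd z) - snd (snd z)\<bar>"
        by linarith
      then show ?case using p by (intro ennreal_leI powr_mono2) auto
    qed
  qed
  also have "\<dots> \<le> ennreal ((A + e + B) powr p)"
  proof -
    have m [measurable]: "(\<lambda>z. \<bar>fst (fst z) - snd (fst z)\<bar>) \<in> borel_measurable G"
        "(\<lambda>z. \<bar>fst (snd z) - snd (snd z)\<bar>) \<in> borel_measurable G" by measurable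
    have "(\<integral>\<^sup>+ z. ennreal (\<bar>fst (fst z) - snd (fst z)\<bar> powr p) \<partial>G) =
        (\<integral>\<^sup>+ z. ennreal (\<bar>fst z - snd z\<bar> powr p) \<partial>distr G borel fst)"
      by (subst nn_integral_distr[OF fs(1)]) (simp_all add: cm)
    then have 1: "(\<integral>\<^sup>+ z. ennreal (\<bar>fst (fst z) - snd (fst z)\<bar> powr p) \<partial>G) \<le> ennreal (A powr p)"
      using mu(2) G(3) by simp
    have "(\<integral>\<^sup>+ z. ennreal (\<bar>fst (snd z) - snd (snd z)\<bar> powr p) \<partial>G) =
        (\<integral>\<^sup>+ z. ennreal (\<bar>fst z - snd z\<bar> powr p) \<partial>distr G borel snd)"
      by (subst nn_integral_distr[OF fs(2)]) (simp_all add: cm)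
    then have 2: "(\<integral>\<^sup>+ z. ennreal (\<bar>fst (snd z) - snd (snd z)\<bar> powr p) \<partial>G) \<le> ennreal (B powr p)"
      using nu(2) G(4) by simp
    \<comment> \<open>On a probability space the constant function \<open>e\<close> has
      \<open>L^p\<close> norm \<open>e\<close>.\<close>
    have 3: "(\<integral>\<^sup>+ z. ennreal ((\<bar>fst (fst z) - snd (fst z)\<bar> + e) powr p) \<partial>G) \<le> ennreal ((A + e) powr p)"
      using e AB p 1 by (intro nn_integral_Minkowski m) (simp_all add: G.emeasure_space_1)
    show ?thesis
      using e AB p by (intro nn_integral_Minkowski[OF _ _ _ _ _ _ _ 3 2]) simp_all
  qed
  finally show ?thesis .
qed


text \<open>\<open>enn2real\<close> sends infinity to 0, so this root is meaningful only together
  with finiteness of \<open>wass_pp\<close>, which the lemmas below assume where it matters.\<close>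

definition wass :: "real \<Rightarrow> real measure \<Rightarrow> real measure \<Rightarrow> real" where
  "wass p a b = enn2real (wass_pp p a b) powr (1 / p)"

lemma wass_nonneg [simp]: "wass p a b \<ge> 0"
  by (simp add: wass_def)

lemma wass_pp_eq:
  assumes "p \<ge> 1" "wass_pp p a b < \<infinity>"
  shows "wass_pp p a b = ennreal (wass p a b powr p)"
  using assms by (simp add: wass_def powr_powr)

lemma wass_le:
  assumes "p \<ge> 1" "C \<ge> 0" "wass_pp p a b \<le> ennreal (C powr p)"
  shows "wass p a b \<le> C"
proof -
  have "enn2real (wass_pp p a b) \<le> C powr p" using assms by (intro enn2real_leI) auto
  then have "wass p a b \<le> (C powr p) powr (1 / p)"
    unfolding wass_def using assms by (intro powr_mono2) auto
  then show ?thesis using assms by (simp add: powr_powr)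
qed

lemma wass_pp_less:
  assumes "p \<ge> 1" "e > 0" "wass_pp p a b < \<infinity>"
  shows "wass_pp p a b < ennreal ((wass p a b + e) powr p)"
proof -
  have "0 < wass p a b + e" using assms by (simp add: add_nonneg_pos)
  then show ?thesis
    unfolding wass_pp_eq[OF assms(1,3)] using assms by (intro ennreal_lessI powr_less_mono2) auto
qed

lemma wass_triangle:
  assumes p: "p \<ge> 1" and b: "prob_space b"
    and fin: "wass_pp p a b < \<infinity>" "wass_pp p b c < \<infinity>"
  shows "wass p a c \<le> wass p a b + wass p b c"
proof (rule field_le_epsilon)
  fix e :: real assume e: "e > 0"
  \<comment> \<open>One third of \<open>e\<close> makes each of the two given bounds strict; the
    remaining third is the gluing error.\<close>
  have "wass_pp p a c \<le> ennreal (((wass p a b + e / 3) + e / 3 + (wass p b c + e / 3)) powr p)"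
    using e p by (intro wass_pp_triangle_less[OF p b] wass_pp_less fin) (auto simp: add_nonneg_pos)
  then have "wass p a c \<le> (wass p a b + e / 3) + e / 3 + (wass p b c + e / 3)"
    using e by (intro wass_le p) auto
  then show "wass p a c \<le> wass p a b + wass p b c + e" by simp
qed

lemma wass_pp_triangle_finite:
  assumes p: "p \<ge> 1" and b: "prob_space b" and fin: "wass_pp p a b < \<infinity>" "wass_pp p b c < \<infinity>"
  shows "wass_pp p a c < \<infinity>"
proof -
  have "wass_pp p a c \<le> ennreal (((wass p a b + 1) + 1 + (wass p b c + 1)) powr p)"
    using p by (intro wass_pp_triangle_less[OF p b] wass_pp_less fin) (auto simp: add_nonneg_pos)
  then show ?thesis by (rule le_less_trans) simp
qed

lemma couplings_distr:
  assumes [measurable]: "f \<in> borel_measurable M" "g \<in> borel_measurable M"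
  shows "distr M borel (\<lambda>x. (f x, g x)) \<in> couplings (distr M borel f) (distr M borel g)"
  by (simp add: couplings_def distr_distr comp_def flip: borel_prod)

lemma wass_pp_distr_le:
  assumes [measurable]: "f \<in> borel_measurable M" "g \<in> borel_measurable M"
  shows "wass_pp p (distr M borel f) (distr M borel g) \<le> (\<integral>\<^sup>+ x. ennreal (\<bar>f x - g x\<bar> powr p) \<partial>M)"
proof -
  have "wass_pp p (distr M borel f) (distr M borel g) \<le>
      (\<integral>\<^sup>+ z. ennreal (\<bar>fst z - snd z\<bar> powr p) \<partial>distr M borel (\<lambda>x. (f x, g x)))"
    by (intro wass_pp_le couplings_distr assms)
  also have "\<dots> = (\<integral>\<^sup>+ x. ennreal (\<bar>f x - g x\<bar> powr p) \<partial>M)"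
    by (subst nn_integral_distr) (auto simp flip: borel_prod)
  finally show ?thesis .
qed

lemma wass_pp_self:
  assumes "sets a = sets borel"
  shows "wass_pp p a a = 0"
proof -
  have "distr a borel (\<lambda>x. x) = a" using assms by (simp add: distr_id2)
  moreover have "(\<lambda>x. x) \<in> borel_measurable a" using assms by (simp add: measurable_ident_sets)
  ultimately show ?thesis using wass_pp_distr_le[of "\<lambda>x. x" a "\<lambda>x. x" p] by simp
qed

lemma norm_iexp_diff_le: "norm (iexp x - iexp y) \<le> \<bar>x - y\<bar>"
proof -
  have "iexp x - iexp y = iexp y * (iexp (x - y) - 1)"
    by (simp add: algebra_simps flip: exp_add)
  then show ?thesis using iexp_approx1[of "x - y" 0] by (simp add: norm_mult)
qed

text \<open>An infimum equal to 0 yields couplings of cost below \<open>d powr p\<close> for each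
  \<open>d > 0\<close>. Since \<open>iexp\<close> is 1-Lipschitz, the characteristic functions
  differ by at most \<open>\<bar>t\<bar>\<close> times the mean of \<open>\<bar>x - y\<bar>\<close>,
  which is at most \<open>2 * d\<close>.\<close>

lemma wass_pp_0_imp_char_eq:
  assumes p: "p \<ge> 1" and a: "prob_space a" and 0: "wass_pp p a b = 0"
  shows "char a t = char b t"
proof -
  have "norm (char a t - char b t) \<le> 2 * \<bar>t\<bar> * d" if d: "d > 0" for d
  proof -
    have "wass_pp p a b < ennreal (d powr p)" using 0 d by simp
    then obtain mu where mu: "mu \<in> couplings a b" "(\<integral>\<^sup>+ z. ennreal (\<bar>fst z - snd z\<bar> powr p) \<partial>mu) < ennreal (d powr p)"
      unfolding wass_pp_def INF_less_iff by blast
    interpret mu: prob_space mu by (rule coupling_prob[OF mu(1) a])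
    note [measurable_cong] = couplings_sets[OF mu(1)]
    have marg: "char a t = (CLINT z|mu. iexp (t * fst z))" "char b t = (CLINT z|mu. iexp (t * snd z))"
      using mu(1) by (auto simp: char_def couplings_def integral_distr)
    \<comment> \<open>Elementary bound of the first moment by the \<open>p\<close>-th one: beyond
      \<open>d\<close> the factor \<open>(u / d) powr (p - 1)\<close> is at least 1.\<close>
    have u: "u \<le> d + d powr (1 - p) * u powr p" if "u \<ge> 0" for u :: real
    proof (cases "u \<le> d")
      case False
      then have "1 \<le> (u / d) powr (p - 1)" using d p by (intro ge_one_powr_ge_zero) auto
      also have "\<dots> = d powr (1 - p) * u powr p / u"
        using False d by (simp add: powr_divide powr_diff)
      finally show ?thesis using False d by (simp add: field_simps)
    qed (simp add: add_increasing2)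
    have "ennreal (norm (char a t - char b t)) = ennreal (norm (CLINT z|mu. iexp (t * fst z) - iexp (t * snd z)))"
      unfolding marg by (subst Bochner_Integration.integral_diff) (auto intro!: mu.integrable_iexp)
    also have "\<dots> \<le> (\<integral>\<^sup>+ z. ennreal (norm (iexp (t * fst z) - iexp (t * snd z))) \<partial>mu)"
      by (intro integral_norm_bound_ennreal Bochner_Integration.integrable_diff mu.integrable_iexp) auto
    also have "\<dots> \<le> (\<integral>\<^sup>+ z. ennreal \<bar>t\<bar> * (ennreal d + ennreal (d powr (1 - p)) * ennreal (\<bar>fst z - snd z\<bar> powr p)) \<partial>mu)"
    proof (intro nn_integral_mono)
      fix z
      have "norm (iexp (t * fst z) - iexp (t * snd z)) \<le> \<bar>t\<bar> * \<bar>fst z - snd z\<bar>"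
        using norm_iexp_diff_le[of "t * fst z" "t * snd z"] by (simp flip: abs_mult right_diff_distrib)
      also have "\<dots> \<le> \<bar>t\<bar> * (d + d powr (1 - p) * \<bar>fst z - snd z\<bar> powr p)"
        by (intro mult_left_mono u) auto
      finally show "ennreal (norm (iexp (t * fst z) - iexp (t * snd z))) \<le>
          ennreal \<bar>t\<bar> * (ennreal d + ennreal (d powr (1 - p)) * ennreal (\<bar>fst z - snd z\<bar> powr p))"
        using d by (simp flip: ennreal_mult ennreal_plus add: ennreal_leI)
    qed
    also have "\<dots> = ennreal \<bar>t\<bar> * (ennreal d + ennreal (d powr (1 - p)) * (\<integral>\<^sup>+ z. ennreal (\<bar>fst z - snd z\<bar> powr p) \<partial>mu))"
      by (simp add: nn_integral_cmult nn_integral_add mu.emeasure_space_1)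
    also have "\<dots> \<le> ennreal \<bar>t\<bar> * (ennreal d + ennreal (d powr (1 - p)) * ennreal (d powr p))"
      using mu(2) by (intro mult_left_mono add_left_mono) auto
    also have "\<dots> = ennreal (2 * \<bar>t\<bar> * d)"
      using d by (simp flip: ennreal_mult ennreal_plus powr_add)
    finally show ?thesis using d by (simp add: ennreal_le_iff)
  qed
  then have "norm (char a t - char b t) \<le> 0 + e" if "e > 0" for e
  proof -
    assume *: "\<And>d. d > 0 \<Longrightarrow> norm (char a t - char b t) \<le> 2 * \<bar>t\<bar> * d"
    \<comment> \<open>The added 1 keeps the denominator positive at \<open>t = 0\<close>.\<close>
    have "norm (char a t - char b t) \<le> 2 * \<bar>t\<bar> * (e / (2 * \<bar>t\<bar> + 1))" using that by (intro *) auto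
    also have "\<dots> \<le> e" using that by (simp add: divide_le_eq)
    finally show ?thesis by simp
  qed
  then have "norm (char a t - char b t) \<le> 0" by (rule field_le_epsilon)
  then show ?thesis by simp
qed

section \<open>Characteristic functions on a Euclidean space\<close>

text \<open>Nonnegative \<open>h\<close> turn \<open>M\<close> and \<open>N\<close> into finite measures to which the one-dimensional uniqueness theorem
  applies. The class is closed under multiplication with \<open>1 + cos\<close>, from which \<open>iexp\<close> is recovered linearly,
  and hence under multiplication with indicators of coordinate slabs, whose products are boxes.\<close>

definition same_transform :: "'a::euclidean_space measure \<Rightarrow> 'a measure \<Rightarrow> ('a \<Rightarrow> real) \<Rightarrow> bool" where
  "same_transform M N h \<longleftrightarrow> h \<in> borel_measurable borel \<and> (\<forall>x. 0 \<le> h x) \<and> (\<exists>C. \<forall>x. h x \<le> C) \<and>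
    (\<forall>u. (CLINT x|M. complex_of_real (h x) * iexp (u \<bullet> x)) = (CLINT x|N. complex_of_real (h x) * iexp (u \<bullet> x)))"

context
  fixes M N :: "'a::euclidean_space measure"
  assumes M: "prob_space M" "sets M = sets borel" and N: "prob_space N" "sets N = sets borel"
begin

lemma
  assumes "same_transform M N h"
  shows same_transform_integrable: "integrable M (\<lambda>x. complex_of_real (h x) * iexp (u \<bullet> x))"
      "integrable N (\<lambda>x. complex_of_real (h x) * iexp (u \<bullet> x))"
    and same_transform_integrable_real: "integrable M h" "integrable N h"
    and same_transform_integral_eq: "(LINT x|M. h x) = (LINT x|N. h x)"
proof -
  interpret M: prob_space M by (rule M)
  interpret N: prob_space N by (rule N)
  note [measurable_cong] = M(2) N(2)
  have [measurable]: "h \<in> borel_measurable borel" using assms by (simp add: same_transform_def)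
  obtain C where C: "\<And>x. h x \<le> C" and h0: "\<And>x. 0 \<le> h x" using assms by (auto simp: same_transform_def)
  show "integrable M (\<lambda>x. complex_of_real (h x) * iexp (u \<bullet> x))" for u
    by (rule M.integrable_const_bound[of _ C]) (use C h0 in \<open>auto simp: norm_mult\<close>)
  show "integrable M h"
    by (rule M.integrable_const_bound[of _ C]) (use C h0 in auto)
  show "integrable N (\<lambda>x. complex_of_real (h x) * iexp (u \<bullet> x))" for u
    by (rule N.integrable_const_bound[of _ C]) (use C h0 in \<open>auto simp: norm_mult\<close>)
  show "integrable N h"
    by (rule N.integrable_const_bound[of _ C]) (use C h0 in auto)
  have "(CLINT x|M. complex_of_real (h x) * iexp (0 \<bullet> x)) = (CLINT x|N. complex_of_real (h x) * iexp (0 \<bullet> x))"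
    using assms unfolding same_transform_def by blast
  then show "(LINT x|M. h x) = (LINT x|N. h x)" by simp
qed

text \<open>Multiplication by a cosine shifts the frequency \<open>u\<close> by \<open>v\<close> and
  by \<open>- v\<close>; this is why the class quantifies over all \<open>u\<close>. Adding 1 keeps
  the weight nonnegative, and the phase \<open>s\<close> will provide sines as well.\<close>

lemma same_transform_cos:
  assumes h: "same_transform M N h"
  shows "same_transform M N (\<lambda>x. h x * (1 + cos (v \<bullet> x + s)))"
  unfolding same_transform_def
proof (intro conjI allI)
  have [measurable]: "h \<in> borel_measurable borel" using h by (simp add: same_transform_def)
  obtain C where C: "\<And>x. h x \<le> C" and h0: "\<And>x. 0 \<le> h x" using h by (auto simp: same_transform_def)
  show "(\<lambda>x. h x * (1 + cos (v \<bullet> x + s))) \<in> borel_measurable borel" by measurable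
  have c: "0 \<le> 1 + cos y" "1 + cos y \<le> 2" for y :: real
    using cos_ge_minus_one[of y] cos_le_one[of y] by linarith+
  show "0 \<le> h x * (1 + cos (v \<bullet> x + s))" for x using h0 c by simp
  have "h x * (1 + cos (v \<bullet> x + s)) \<le> C * 2" for x
    using C[of x] h0[of x] c[of "v \<bullet> x + s"] by (intro mult_mono) auto
  then show "\<exists>C. \<forall>x. h x * (1 + cos (v \<bullet> x + s)) \<le> C" by blast
  fix u
  let ?e = "\<lambda>u x. complex_of_real (h x) * iexp (u \<bullet> x)"
  have split: "complex_of_real (h x * (1 + cos (v \<bullet> x + s))) * iexp (u \<bullet> x) =
      ?e u x + (iexp s / 2 * ?e (u + v) x + iexp (- s) / 2 * ?e (u - v) x)" for x
  proof -
    have "complex_of_real (cos (v \<bullet> x + s)) = (iexp (v \<bullet> x + s) + iexp (- (v \<bullet> x + s))) / 2"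
      by (simp add: cos_of_real[symmetric] cos_exp_eq algebra_simps)
    moreover have "iexp (v \<bullet> x + s) = iexp s * iexp (v \<bullet> x)"
      by (simp add: distrib_left exp_add)
    moreover have "iexp (- (v \<bullet> x + s)) = iexp (- s) * iexp (- (v \<bullet> x))"
      by (simp add: algebra_simps flip: exp_add)
    moreover have "iexp ((u + v) \<bullet> x) = iexp (u \<bullet> x) * iexp (v \<bullet> x)"
      by (simp add: inner_add_left distrib_left exp_add)
    moreover have "iexp ((u - v) \<bullet> x) = iexp (u \<bullet> x) * iexp (- (v \<bullet> x))"
      by (simp add: inner_diff_left algebra_simps flip: exp_add)
    moreover have "H * (1 + (S * V + S' * V') / 2) * E = H * E + (S / 2 * (H * (E * V)) + S' / 2 * (H * (E * V')))"
      for H S V S' V' E :: complex by (simp add: field_simps)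
    ultimately show ?thesis
      by (simp only: of_real_mult of_real_add of_real_1)
  qed
  have eq: "integral\<^sup>L M (?e u) = integral\<^sup>L N (?e u)" for u
    using h unfolding same_transform_def by blast
  note int = same_transform_integrable[OF h]
  show "(CLINT x|M. complex_of_real (h x * (1 + cos (v \<bullet> x + s))) * iexp (u \<bullet> x)) =
      (CLINT x|N. complex_of_real (h x * (1 + cos (v \<bullet> x + s))) * iexp (u \<bullet> x))"
  proof -
    have lin: "(CLINT x|K. f x + (a * g x + b * k x)) = integral\<^sup>L K f + (a * integral\<^sup>L K g + b * integral\<^sup>L K k)"
      if "integrable K f" "integrable K g" "integrable K k" for K :: "'a measure" and f g k and a b :: complex
      using that by simp
    show ?thesis unfolding split by (simp only: lin int eq)
  qed
qed

text \<open>Weight \<open>M\<close> and \<open>N\<close> by \<open>h / c\<close> and project along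
  \<open>b\<close>. The characteristic function of the projection at \<open>t\<close> is the
  transform at \<open>t *\<^sub>R b\<close> divided by \<open>c\<close>, so Levy uniqueness on the
  line applies.\<close>

lemma same_transform_integral_indicator:
  assumes h: "same_transform M N h" and B: "B \<in> sets borel"
  shows "(LINT x|M. h x * indicator B (x \<bullet> b)) = (LINT x|N. h x * indicator B (x \<bullet> b))"
proof -
  note [measurable_cong] = M(2) N(2)
  note [measurable] = B
  have [measurable]: "h \<in> borel_measurable borel" and h0: "\<And>x. 0 \<le> h x"
    using h by (auto simp: same_transform_def)
  define c where "c = (LINT x|M. h x)"
  have cN: "c = (LINT x|N. h x)" unfolding c_def by (rule same_transform_integral_eq[OF h])
  have c0: "c \<ge> 0" unfolding c_def using h0 by simp
  define P where "P K = distr (density K (\<lambda>x. ennreal (h x / c))) borel (\<lambda>x. x \<bullet> b)" for K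
  have K: "real_distribution (P K) \<and> char (P K) t = (CLINT x|K. complex_of_real (h x) * iexp ((t *\<^sub>R b) \<bullet> x)) / c \<and>
      measure (P K) B = (LINT x|K. h x * indicator B (x \<bullet> b)) / c"
    if c: "c > 0" and [measurable_cong]: "sets K = sets borel" and i: "integrable K h" and cK: "c = (LINT x|K. h x)" for K t
  proof -
    have "emeasure (density K (\<lambda>x. ennreal (h x / c))) (space K) = (\<integral>\<^sup>+x. ennreal (h x / c) \<partial>K)"
      by (subst emeasure_density) (auto intro!: nn_integral_cong)
    also have "\<dots> = ennreal (LINT x|K. h x / c)"
      using i h0 c by (intro nn_integral_eq_integral) auto
    also have "\<dots> = 1" using c by (simp flip: cK)
    finally have "prob_space (density K (\<lambda>x. ennreal (h x / c)))" by (intro prob_spaceI) simp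
    then have r: "real_distribution (P K)"
      unfolding P_def real_distribution_def real_distribution_axioms_def by (auto intro!: prob_space.prob_space_distr)
    interpret PK: real_distribution "P K" by (rule r)
    have "char (P K) t = (CLINT x|K. (h x / c) *\<^sub>R iexp (t * (x \<bullet> b)))"
      unfolding char_def P_def using c h0 by (subst integral_distr, simp, simp) (subst integral_density, auto)
    also have "\<dots> = (CLINT x|K. complex_of_real (h x) * iexp ((t *\<^sub>R b) \<bullet> x) / c)"
      by (intro Bochner_Integration.integral_cong) (auto simp: scaleR_conv_of_real inner_commute)
    finally have 1: "char (P K) t = (CLINT x|K. complex_of_real (h x) * iexp ((t *\<^sub>R b) \<bullet> x)) / c"
      by simp
    have "measure (P K) B = (LINT y|P K. indicator B y)" by simp
    also have "\<dots> = (LINT x|K. (h x / c) *\<^sub>R indicator B (x \<bullet> b))"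
      unfolding P_def using c h0 by (subst integral_distr, simp, simp) (subst integral_density, auto)
    also have "\<dots> = (LINT x|K. h x * indicator B (x \<bullet> b)) / c" by simp
    finally show ?thesis using r 1 by blast
  qed
  note i = same_transform_integrable_real[OF h]
  show ?thesis
  proof (cases "c = 0")
    \<comment> \<open>No normalisation is possible here, but then \<open>h\<close> vanishes almost
      everywhere under both measures.\<close>
    case True
    have "(LINT x|K. h x * indicator B (x \<bullet> b)) = 0" if [measurable_cong]: "sets K = sets borel" and i: "integrable K h"
      and c: "(LINT x|K. h x) = 0" for K
    proof -
      have "AE x in K. h x = 0" using c h0 i by (simp add: integral_nonneg_eq_0_iff_AE)
      then have "AE x in K. h x * indicator B (x \<bullet> b) = 0" by eventually_elim simp
      then show ?thesis by (subst integral_cong_AE[of _ _ "\<lambda>x. 0"]) auto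
    qed
    then show ?thesis using i M N True cN c_def by simp
  next
    case False
    with c0 have c: "c > 0" by simp
    note KM = K[OF c M(2) i(1) c_def] and KN = K[OF c N(2) i(2) cN]
    have "char (P M) = char (P N)"
    proof
      fix t
      have "(CLINT x|M. complex_of_real (h x) * iexp ((t *\<^sub>R b) \<bullet> x)) =
          (CLINT x|N. complex_of_real (h x) * iexp ((t *\<^sub>R b) \<bullet> x))"
        using h unfolding same_transform_def by blast
      then show "char (P M) t = char (P N) t" using KM[of t] KN[of t] by simp
    qed
    then have "P M = P N" using KM KN by (intro Levy_uniqueness) auto
    then show ?thesis using KM KN c by simp
  qed
qed

text \<open>\<open>iexp\<close> is split into cosine and sine, each written as (1 + cosine) - 1 with
  phase 0 or \<open>- (pi / 2)\<close>. Every piece is then a real integral of a member of the class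
  against a slab, covered by the preceding lemma.\<close>

lemma same_transform_indicator:
  assumes h: "same_transform M N h" and B: "B \<in> sets borel"
  shows "same_transform M N (\<lambda>x. h x * indicator B (x \<bullet> b))"
  unfolding same_transform_def
proof (intro conjI allI)
  note [measurable_cong] = M(2) N(2)
  note [measurable] = B
  have [measurable]: "h \<in> borel_measurable borel" using h by (simp add: same_transform_def)
  obtain C where C: "\<And>x. h x \<le> C" and h0: "\<And>x. 0 \<le> h x" using h by (auto simp: same_transform_def)
  show "(\<lambda>x. h x * indicator B (x \<bullet> b)) \<in> borel_measurable borel" by measurable
  show "0 \<le> h x * indicator B (x \<bullet> b)" for x using h0 by simp
  have "h x * indicator B (x \<bullet> b) \<le> C" for x
    using C[of x] h0[of x] by (auto simp: indicator_def)
  then show "\<exists>C. \<forall>x. h x * indicator B (x \<bullet> b) \<le> C" by blast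
  fix u
  define k where "k s x = h x * (1 + cos (u \<bullet> x + s)) * indicator B (x \<bullet> b)" for s x
  define k0 where "k0 x = h x * indicator B (x \<bullet> b)" for x
  have good: "same_transform M N (\<lambda>x. h x * (1 + cos (u \<bullet> x + s)))" for s
    by (rule same_transform_cos[OF h])
  have eq: "integral\<^sup>L M (k s) = integral\<^sup>L N (k s)" "integral\<^sup>L M k0 = integral\<^sup>L N k0" for s
    unfolding k_def k0_def by (rule same_transform_integral_indicator[OF good B] same_transform_integral_indicator[OF h B])+
  have ind: "integrable K (\<lambda>x. g x * indicator B (x \<bullet> b))"
    if [measurable_cong]: "sets K = sets borel" and g: "integrable K g" for K and g :: "'a \<Rightarrow> real"
  proof (rule Bochner_Integration.integrable_bound[OF g])
    have [measurable]: "g \<in> borel_measurable K" using g by simp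
    show "(\<lambda>x. g x * indicator B (x \<bullet> b)) \<in> borel_measurable K" by measurable
  qed (auto simp: indicator_def)
  have int: "integrable K (k s)" "integrable K k0" if "sets K = sets borel"
    and "integrable K h" "\<And>s. integrable K (\<lambda>x. h x * (1 + cos (u \<bullet> x + s)))" for K s
    unfolding k_def k0_def by (intro ind that)+
  have split: "complex_of_real (h x * indicator B (x \<bullet> b)) * iexp (u \<bullet> x) =
      complex_of_real (k 0 x - k0 x) + \<i> * complex_of_real (k (- (pi / 2)) x - k0 x)" for x
  proof -
    have "cos (u \<bullet> x + - (pi / 2)) = sin (u \<bullet> x)" by (simp add: cos_diff)
    then show ?thesis
      unfolding k_def k0_def by (simp add: exp_Euler cos_of_real sin_of_real) (simp add: algebra_simps)
  qed
  show "(CLINT x|M. complex_of_real (h x * indicator B (x \<bullet> b)) * iexp (u \<bullet> x)) =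
      (CLINT x|N. complex_of_real (h x * indicator B (x \<bullet> b)) * iexp (u \<bullet> x))"
  proof -
    have *: "(CLINT x|K. complex_of_real (h x * indicator B (x \<bullet> b)) * iexp (u \<bullet> x)) =
      complex_of_real (integral\<^sup>L K (k 0) - integral\<^sup>L K k0) + \<i> * complex_of_real (integral\<^sup>L K (k (- (pi / 2))) - integral\<^sup>L K k0)"
      if "integrable K (k 0)" "integrable K (k (- (pi / 2)))" "integrable K k0" for K
      unfolding split using that
      by (subst Bochner_Integration.integral_add)
        (auto intro!: integrable_mult_right integrable_of_real Bochner_Integration.integrable_diff simp del: of_real_diff)
    show ?thesis
      using M(2) N(2) same_transform_integrable_real[OF h] same_transform_integrable_real[OF good] eq
      by (subst (1 2) *) (auto intro!: int)
  qed
qed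

theorem char_uniqueness:
  assumes eq: "\<And>u. (CLINT x|M. iexp (u \<bullet> x)) = (CLINT x|N. iexp (u \<bullet> x))"
  shows "M = N"
proof -
  interpret M: prob_space M by (rule M)
  interpret N: prob_space N by (rule N)
  have 1: "same_transform M N (\<lambda>x. 1)" using eq by (auto simp: same_transform_def)
  have box: "emeasure M (box a c) = emeasure N (box a c)" for a c
  proof -
    \<comment> \<open>Starting from the constant 1, each basis vector contributes one slab; over the
      whole basis the product is the indicator of the box.\<close>
    have ind: "same_transform M N (\<lambda>x. \<Prod>b\<in>S. indicator {a \<bullet> b <..< c \<bullet> b} (x \<bullet> b))" if "finite S" for S
      using that
    proof induction
      case (insert b S)
      then show ?case using same_transform_indicator[OF insert.IH, of "{a \<bullet> b <..< c \<bullet> b}" b] by (simp add: mult.commute)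
    qed (use 1 in simp)
    have "(\<lambda>x. \<Prod>b\<in>Basis. indicator {a \<bullet> b <..< c \<bullet> b} (x \<bullet> b)) = (indicator (box a c) :: 'a \<Rightarrow> real)"
      by (auto simp: fun_eq_iff indicator_def box_def prod_zero_iff)
    then have "(LINT x|M. indicator (box a c) x) = (LINT x|N. indicator (box a c) x :: real)"
      using same_transform_integral_eq[OF ind[OF finite_Basis]] by simp
    then have "measure M (box a c) = measure N (box a c)"
      using sets_eq_imp_space_eq[OF M(2)] sets_eq_imp_space_eq[OF N(2)] by simp
    then show ?thesis by (simp add: M.emeasure_eq_measure N.emeasure_eq_measure)
  qed
  let ?E = "range (\<lambda>(a, b). box a b :: 'a set)"
  show ?thesis
  proof (rule measure_eqI_generator_eq)
    show "Int_stable ?E" by (auto simp: Int_stable_def box_Int_box)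
    show "?E \<subseteq> Pow UNIV" "sets M = sigma_sets UNIV ?E" "sets N = sigma_sets UNIV ?E"
      using M(2) N(2) by (simp_all add: borel_eq_box)
    let ?A = "\<lambda>n::nat. box (- (real n *\<^sub>R One)) (real n *\<^sub>R One) :: 'a set"
    show "range ?A \<subseteq> ?E" "(\<Union>i. ?A i) = UNIV"
      unfolding UN_box_eq_UNIV by auto
    show "emeasure M (?A n) \<noteq> \<infinity>" for n by simp
    show "emeasure M X = emeasure N X" if "X \<in> ?E" for X
      using that box by auto
  qed
qed

end

section \<open>Uniform directions\<close>

lemma emeasure_lborel_open_pos:
  fixes T :: "'a::euclidean_space set"
  assumes "open T" "x \<in> T"
  shows "emeasure lborel T > 0"
proof -
  obtain r where r: "r > 0" "ball x r \<subseteq> T" using assms open_contains_ball by blast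
  have "measure lborel (ball x r) > 0" using r by (simp add: content_ball_pos)
  then have "emeasure lborel (ball x r) \<noteq> 0" by (auto simp: measure_def)
  moreover have "emeasure lborel (ball x r) \<le> emeasure lborel T"
    using r assms by (intro emeasure_mono) auto
  ultimately show ?thesis by (metis not_gr_zero le_zero_eq)
qed

lemma unif_ball_prob: "prob_space (uniform_measure lborel (ball (0::'a::euclidean_space) 1))"
  using emeasure_lborel_open_pos[of "ball (0::'a) 1" 0] emeasure_lborel_ball_finite[of "0::'a" 1]
  by (intro prob_space_uniform_measure) auto

context
  fixes P :: "'a::euclidean_space \<Rightarrow> 'b::euclidean_space"
  assumes P: "bounded_linear P"
begin

lemma measurable_sgn_linear: "(\<lambda>x. sgn (P x)) \<in> borel_measurable (uniform_measure lborel (ball 0 1))"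
proof -
  have "P \<in> borel_measurable borel"
    using P by (intro borel_measurable_continuous_onI linear_continuous_on)
  then have "P \<in> borel_measurable (uniform_measure lborel (ball 0 1))" by simp
  then show ?thesis unfolding sgn_div_norm by measurable
qed

lemma unif_dir_prob: "prob_space (unif_dir P)"
  unfolding unif_dir_def by (rule prob_space.prob_space_distr[OF unif_ball_prob measurable_sgn_linear])

text \<open>\<open>sgn\<close> maps the kernel of \<open>P\<close> to 0 and everything else to norm
  1, so the bound holds pointwise. It is what keeps the average over directions finite.\<close>

lemma unif_dir_norm_le: "AE x in unif_dir P. norm x \<le> 1"
  unfolding unif_dir_def
  by (subst AE_distr_iff[OF measurable_sgn_linear]) (auto simp: norm_sgn)

text \<open>\<open>sgn (P x)\<close> is unchanged under positive scaling of \<open>x\<close>, so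
  \<open>x\<close> may be moved into the unit ball, here to norm 1/2. Near it the map is continuous
  because \<open>P x\<close> is nonzero, hence the preimage of \<open>T\<close> contains a nonempty
  open set.\<close>

lemma unif_dir_open_pos:
  assumes T: "open T" "sgn (P x) \<in> T" and x: "P x \<noteq> 0"
  shows "emeasure (unif_dir P) T > 0"
proof -
  interpret P: bounded_linear P by (rule P)
  let ?B = "ball (0::'a) 1"
  let ?A = "{y. P y \<noteq> 0}"
  let ?S = "?B \<inter> (?A \<inter> (\<lambda>y. sgn (P y)) -` T)"
  have oA: "open ?A" by (intro open_Collect_neq P.continuous_on continuous_intros)
  have "continuous_on ?A (\<lambda>y. sgn (P y))"
    unfolding sgn_div_norm by (intro continuous_intros P.continuous_on) auto
  then have oS: "open ?S"
    using oA T(1) by (intro open_Int[OF open_ball] continuous_open_preimage)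
  have "x \<noteq> 0" using x P.zero by auto
  then have "(1 / (2 * norm x)) *\<^sub>R x \<in> ?S"
    using T(2) x by (simp add: P.scaleR sgn_scaleR)
  then have "0 < emeasure lborel ?S" using oS emeasure_lborel_open_pos by blast
  also have "\<dots> \<le> emeasure lborel (?B \<inter> (\<lambda>x. sgn (P x)) -` T)"
  proof (intro emeasure_mono)
    show "?B \<inter> (\<lambda>x. sgn (P x)) -` T \<in> sets lborel"
      using measurable_sets[OF measurable_sgn_linear borel_open[OF T(1)]] by simp
  qed auto
  finally have "0 < emeasure lborel (?B \<inter> (\<lambda>x. sgn (P x)) -` T) / emeasure lborel ?B"
    using emeasure_lborel_ball_finite[of "0::'a" 1] by (simp add: ennreal_zero_less_divide)
  also have "\<dots> = emeasure (unif_dir P) T"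
    using measurable_sets[OF measurable_sgn_linear borel_open[OF T(1)]]
    unfolding unif_dir_def by (subst emeasure_distr[OF measurable_sgn_linear borel_open[OF T(1)]]) simp
  finally show ?thesis .
qed

end

lemma sets_unif_dir [measurable_cong]: "sets (unif_dir P) = sets borel"
  by (simp add: unif_dir_def)

lemma bounded_linear_sym_part: "bounded_linear (sym_part :: real^'d^'d \<Rightarrow> _)"
proof -
  have "linear (sym_part :: real^'d^'d \<Rightarrow> _)"
    by (rule linearI) (auto simp: sym_part_def transpose_def vec_eq_iff algebra_simps)
  then show ?thesis by (simp add: linear_conv_bounded_linear)
qed

section \<open>The law of the mixed direction: norm bound and full support\<close>

type_synonym 'd mix = "(real^2) \<times> (real^'d) \<times> (real^'d^'d)"

abbreviation unif_mix :: "('d::finite mix) measure" where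
  "unif_mix \<equiv> unif_S1 \<Otimes>\<^sub>M (unif_Sd \<Otimes>\<^sub>M unif_SymS)"

definition mix_dir :: "'d::finite mix \<Rightarrow> (real^'d) \<times> (real^'d^'d)" where
  "mix_dir z = ((fst z $ 1) *\<^sub>R fst (snd z), (fst z $ 2) *\<^sub>R snd (snd z))"

lemma continuous_on_mix_dir: "continuous_on S mix_dir"
  unfolding mix_dir_def by (intro continuous_intros)

lemma sets_unif_mix: "sets (unif_mix :: 'd::finite mix measure) = sets borel"
proof -
  have "sets (unif_mix :: 'd mix measure) = sets (borel \<Otimes>\<^sub>M (borel \<Otimes>\<^sub>M borel))"
    by (intro sets_pair_measure_cong sets_unif_dir)
  then show ?thesis by (simp only: borel_prod)
qed

lemmas unif_mix_factors =
  unif_dir_prob[OF bounded_linear_ident] unif_dir_prob[OF bounded_linear_ident] unif_dir_prob[OF bounded_linear_sym_part]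

lemma prob_space_unif_mix: "prob_space (unif_mix :: 'd::finite mix measure)"
  by (intro prob_space_pair unif_mix_factors)

text \<open>The blocks \<open>v\<close> and \<open>A\<close> enter the squared norm with weights
  \<open>w\<^sub>1\<^sup>2\<close> and \<open>w\<^sub>2\<^sup>2\<close>, so it is at most the
  squared norm of \<open>w\<close>.\<close>

lemma unif_mix_norm_le: "AE z in (unif_mix :: 'd::finite mix measure). norm (mix_dir z) \<le> 1"
proof -
  interpret S1: prob_space unif_S1 by (rule unif_mix_factors)
  interpret Sd: prob_space "unif_Sd :: (real^'d) measure" by (rule unif_mix_factors)
  interpret SS: prob_space "unif_SymS :: (real^'d^'d) measure" by (rule unif_mix_factors)
  interpret dS: pair_prob_space "unif_Sd :: (real^'d) measure" "unif_SymS :: (real^'d^'d) measure" ..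
  interpret dS': prob_space "(unif_Sd :: (real^'d) measure) \<Otimes>\<^sub>M (unif_SymS :: (real^'d^'d) measure)"
    by (intro prob_space_pair unif_mix_factors)
  interpret SdS: pair_prob_space unif_S1 "(unif_Sd :: (real^'d) measure) \<Otimes>\<^sub>M (unif_SymS :: (real^'d^'d) measure)" ..
  note le = unif_dir_norm_le[OF bounded_linear_ident] unif_dir_norm_le[OF bounded_linear_sym_part]
  have "AE y in (unif_Sd :: (real^'d) measure) \<Otimes>\<^sub>M (unif_SymS :: (real^'d^'d) measure). norm (fst y) \<le> 1 \<and> norm (snd y) \<le> 1"
  proof (rule dS.AE_pair_measure)
    show "AE x in (unif_Sd :: (real^'d) measure). AE y in (unif_SymS :: (real^'d^'d) measure). norm (fst (x, y)) \<le> 1 \<and> norm (snd (x, y)) \<le> 1"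
      using le(1) by eventually_elim (use le(2) in simp)
  qed measurable
  then have "AE z in (unif_mix :: 'd mix measure). norm (fst z) \<le> 1 \<and> norm (fst (snd z)) \<le> 1 \<and> norm (snd (snd z)) \<le> 1"
    (is "AE z in _. ?Q z")
  proof (intro SdS.AE_pair_measure)
    assume *: "AE y in (unif_Sd :: (real^'d) measure) \<Otimes>\<^sub>M (unif_SymS :: (real^'d^'d) measure). norm (fst y) \<le> 1 \<and> norm (snd y) \<le> 1"
    show "AE x in unif_S1. AE y in (unif_Sd :: (real^'d) measure) \<Otimes>\<^sub>M (unif_SymS :: (real^'d^'d) measure). ?Q (x, y)"
      using le(1) by eventually_elim (use * in simp)
  qed measurable
  then show ?thesis
  proof eventually_elim
    case (elim z)
    have "(norm (mix_dir z))\<^sup>2 = (fst z $ 1)\<^sup>2 * (norm (fst (snd z)))\<^sup>2 + (fst z $ 2)\<^sup>2 * (norm (snd (snd z)))\<^sup>2"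
      by (simp add: mix_dir_def norm_Pair power_mult_distrib)
    also have "\<dots> \<le> (fst z $ 1)\<^sup>2 * 1 + (fst z $ 2)\<^sup>2 * 1"
      using elim by (intro add_mono mult_left_mono) (auto simp: power_le_one)
    also have "\<dots> = (norm (fst z))\<^sup>2"
      by (simp add: norm_vec_def L2_set_def sum_2)
    also have "\<dots> \<le> 1" using elim by (simp add: power_le_one)
    finally show ?case using power2_le_imp_le[of "norm (mix_dir z)" 1] by simp
  qed
qed

lemma unif_mix_open_pos:
  fixes T :: "'d::finite mix set"
  assumes T: "open T" "(sgn w, sgn v, sgn (sym_part A)) \<in> T" and ne: "w \<noteq> 0" "v \<noteq> 0" "sym_part A \<noteq> 0"
  shows "emeasure unif_mix T > 0"
proof -
  interpret S1: prob_space unif_S1 by (rule unif_mix_factors)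
  interpret Sd: prob_space "unif_Sd :: (real^'d) measure" by (rule unif_mix_factors)
  interpret SS: prob_space "unif_SymS :: (real^'d^'d) measure" by (rule unif_mix_factors)
  interpret dS: prob_space "(unif_Sd :: (real^'d) measure) \<Otimes>\<^sub>M (unif_SymS :: (real^'d^'d) measure)"
    by (intro prob_space_pair unif_mix_factors)
  obtain T1 T' where 1: "open T1" "open T'" "sgn w \<in> T1" "(sgn v, sgn (sym_part A)) \<in> T'" "T1 \<times> T' \<subseteq> T"
    using open_prod_elim[OF T] by (metis mem_Times_iff fst_conv snd_conv)
  obtain T2 T3 where 2: "open T2" "open T3" "sgn v \<in> T2" "sgn (sym_part A) \<in> T3" "T2 \<times> T3 \<subseteq> T'"
    using open_prod_elim[OF 1(2,4)] by (metis mem_Times_iff fst_conv snd_conv)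
  have "0 < emeasure unif_S1 T1 * (emeasure unif_Sd T2 * emeasure unif_SymS T3)"
    using unif_dir_open_pos[OF bounded_linear_ident 1(1,3) ne(1)]
      unif_dir_open_pos[OF bounded_linear_ident 2(1,3) ne(2)]
      unif_dir_open_pos[OF bounded_linear_sym_part 2(2,4) ne(3)]
    by (simp add: ennreal_zero_less_mult_iff)
  also have "\<dots> = emeasure (unif_mix :: 'd mix measure) (T1 \<times> (T2 \<times> T3))"
    using 1 2 by (subst dS.emeasure_pair_measure_Times) (auto simp: SS.emeasure_pair_measure_Times sets_unif_dir)
  also have "\<dots> \<le> emeasure unif_mix T"
    using 1 2 T by (intro emeasure_mono) (auto simp: sets_unif_mix)
  finally show ?thesis .
qed

section \<open>Slices of measures on a Euclidean space\<close>

abbreviation slice :: "'a::euclidean_space measure \<Rightarrow> 'a \<Rightarrow> real measure" where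
  "slice H u \<equiv> distr H borel (\<lambda>y. u \<bullet> y)"

text \<open>\<open>m\<close> is an upper bound for the \<open>L^p\<close> norm of the identity under
  \<open>H\<close>; it becomes the Lipschitz constant of the slice as a function of its
  direction.\<close>

locale moment_measure = prob_space H for H :: "'a::euclidean_space measure" +
  fixes p m :: real
  assumes p: "p \<ge> 1" and m: "m \<ge> 0" and sets_H [measurable_cong]: "sets H = sets borel"
    and moment: "(\<integral>\<^sup>+ y. ennreal (norm y powr p) \<partial>H) \<le> ennreal (m powr p)"
begin

lemma prob_slice: "prob_space (slice H u)"
  by (rule prob_space_distr) simp

text \<open>Projecting the same \<open>y\<close> in both directions is a coupling of the slices; its
  cost is controlled by Cauchy-Schwarz.\<close>

lemma wass_pp_slice_le: "wass_pp p (slice H u) (slice H v) \<le> ennreal ((norm (u - v) * m) powr p)"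
proof -
  have "wass_pp p (slice H u) (slice H v) \<le> (\<integral>\<^sup>+ y. ennreal (\<bar>u \<bullet> y - v \<bullet> y\<bar> powr p) \<partial>H)"
    by (rule wass_pp_distr_le) simp_all
  also have "\<dots> \<le> (\<integral>\<^sup>+ y. ennreal (norm (u - v) powr p) * ennreal (norm y powr p) \<partial>H)"
  proof (rule nn_integral_mono)
    fix y
    have "\<bar>u \<bullet> y - v \<bullet> y\<bar> powr p \<le> (norm (u - v) * norm y) powr p"
      using p Cauchy_Schwarz_ineq2[of "u - v" y] by (intro powr_mono2) (auto simp: inner_diff_left)
    then show "ennreal (\<bar>u \<bullet> y - v \<bullet> y\<bar> powr p) \<le> ennreal (norm (u - v) powr p) * ennreal (norm y powr p)"
      by (simp add: powr_mult ennreal_leI flip: ennreal_mult)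
  qed
  also have "\<dots> = ennreal (norm (u - v) powr p) * (\<integral>\<^sup>+ y. ennreal (norm y powr p) \<partial>H)"
    by (simp add: nn_integral_cmult)
  also have "\<dots> \<le> ennreal (norm (u - v) powr p) * ennreal (m powr p)"
    using moment by (intro mult_left_mono) auto
  also have "\<dots> = ennreal ((norm (u - v) * m) powr p)"
    using m by (simp add: powr_mult flip: ennreal_mult)
  finally show ?thesis .
qed

lemma wass_pp_slice_finite: "wass_pp p (slice H u) (slice H v) < \<infinity>"
  using wass_pp_slice_le by (rule le_less_trans) simp

lemma wass_slice_le: "wass p (slice H u) (slice H v) \<le> norm (u - v) * m"
  using p m by (intro wass_le wass_pp_slice_le) auto

lemma slice_0: "slice H 0 = return borel 0"
  using distr_const[of 0 borel] by simp

end

locale moment_measure2 = H: moment_measure H p m + K: moment_measure K p n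
  for H K :: "'a::euclidean_space measure" and p m n
begin

text \<open>The bridge between different measures is direction 0, where both slices are the Dirac
  measure at 0.\<close>

lemma wass_pp_slices_finite: "wass_pp p (slice H u) (slice K v) < \<infinity>"
proof (rule wass_pp_triangle_finite[OF H.p H.prob_slice[of 0] H.wass_pp_slice_finite])
  have "slice H 0 = slice K 0" by (simp only: H.slice_0 K.slice_0)
  then show "wass_pp p (slice H 0) (slice K v) < \<infinity>" by (simp only: K.wass_pp_slice_finite)
qed

lemma wass_slices_le: "wass p (slice H u) (slice K u) \<le> norm u * (m + n)"
proof -
  have "wass p (slice H u) (slice K u) \<le> wass p (slice H u) (slice H 0) + wass p (slice H 0) (slice K u)"
    by (intro wass_triangle H.p H.prob_slice wass_pp_slices_finite H.wass_pp_slice_finite)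
  also have "slice H 0 = slice K 0" by (simp add: H.slice_0 K.slice_0)
  finally show ?thesis
    using H.wass_slice_le[of u 0] K.wass_slice_le[of 0 u]
    by (simp add: H.slice_0 K.slice_0 distrib_left)
qed

text \<open>Path of three moves: \<open>u\<close> to \<open>v\<close> within \<open>H\<close>,
  across from \<open>H\<close> to \<open>K\<close> at \<open>v\<close>, and back to \<open>u\<close>
  within \<open>K\<close>.\<close>

lemma wass_slices_lipschitz:
  "wass p (slice H u) (slice K u) \<le> wass p (slice H v) (slice K v) + norm (u - v) * (m + n)"
proof -
  have "wass p (slice H u) (slice K u) \<le> wass p (slice H u) (slice H v) + wass p (slice H v) (slice K u)"
    by (intro wass_triangle H.p H.prob_slice wass_pp_slices_finite H.wass_pp_slice_finite)
  also have "wass p (slice H v) (slice K u) \<le> wass p (slice H v) (slice K v) + wass p (slice K v) (slice K u)"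
    by (intro wass_triangle H.p K.prob_slice wass_pp_slices_finite K.wass_pp_slice_finite)
  finally show ?thesis
    using H.wass_slice_le[of u v] K.wass_slice_le[of v u] by (simp add: norm_minus_commute distrib_left)
qed

lemma continuous_wass_slices: "continuous_on S (\<lambda>u. wass p (slice H u) (slice K u))"
proof (rule continuous_on_subset[of UNIV])
  have "(m + n)-lipschitz_on UNIV (\<lambda>u. wass p (slice H u) (slice K u))"
  proof (rule lipschitz_onI)
    show "dist (wass p (slice H u) (slice K u)) (wass p (slice H v) (slice K v)) \<le> (m + n) * dist u v" for u v
      using wass_slices_lipschitz[of u v] wass_slices_lipschitz[of v u]
      by (simp add: dist_norm norm_minus_commute abs_le_iff mult.commute)
  qed (use H.m K.m in simp)
  then show "continuous_on UNIV (\<lambda>u. wass p (slice H u) (slice K u))" by (rule lipschitz_on_continuous_on)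
qed simp

end

lemma continuous_on_char:
  fixes F :: "'b \<Rightarrow> 'a::euclidean_space"
  assumes "prob_space M" and [measurable]: "F \<in> borel_measurable M"
  shows "continuous_on S (\<lambda>u. CLINT x|M. iexp (u \<bullet> F x))"
proof -
  interpret prob_space M by fact
  show ?thesis
  proof (rule continuous_at_imp_continuous_on, rule ballI)
    fix u assume "u \<in> S"
    show "isCont (\<lambda>u. CLINT x|M. iexp (u \<bullet> F x)) u"
      unfolding continuous_at_sequentially comp_def
    proof (intro allI impI, rule integral_dominated_convergence[where w = "\<lambda>x. 1"])
      fix X assume X: "X \<longlonglongrightarrow> u"
      show "AE x in M. (\<lambda>n. iexp (X n \<bullet> F x)) \<longlonglongrightarrow> iexp (u \<bullet> F x)"
        by (intro always_eventually allI tendsto_intros X)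
    qed auto
  qed
qed

section \<open>The mixed sliced Wasserstein distance\<close>

definition log_embed :: "(real^'d) \<times> (real^'d^'d) \<Rightarrow> (real^'d) \<times> (real^'d^'d)" where
  "log_embed x = (fst x, mlog (snd x))"

lemma measurable_log_embed [measurable]:
  "(log_embed :: (real^'d) \<times> (real^'d^'d) \<Rightarrow> _) \<in> borel_measurable borel"
  unfolding log_embed_def borel_prod[symmetric] by measurable

lemma trace_mult_symmetric:
  assumes "transpose L = L"
  shows "trace (A ** L) = A \<bullet> (L :: real^'d^'d)"
proof -
  have "L $ k $ i = L $ i $ k" for i k
    using arg_cong[OF assms, of "\<lambda>L. L $ i $ k"] by (simp add: transpose_def)
  then show ?thesis by (simp add: trace_def matrix_matrix_mult_def inner_vec_def)
qed

lemma inner_transpose: "transpose A \<bullet> B = A \<bullet> transpose (B :: real^'d^'d)"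
  unfolding inner_vec_def transpose_def by simp (rule sum.swap)

lemma proj_mix_eq_inner:
  "proj_mix (fst z) (fst (snd z)) (snd (snd z)) x = mix_dir z \<bullet> log_embed x"
  by (simp add: proj_mix_def mix_dir_def log_embed_def trace_mult_symmetric mlog_symmetric inner_commute)

lemma Pstar_moment:
  fixes G :: "((real^'d) \<times> (real^'d^'d)) measure"
  assumes G: "G \<in> Pstar p" and p: "p \<ge> 1"
  obtains m where "moment_measure (distr G borel log_embed) p m"
proof -
  have sG [measurable_cong]: "sets G = sets borel" and "prob_space G"
    and fin: "\<And>x0. snd x0 \<in> SPD \<Longrightarrow> (\<integral>\<^sup>+ x. ennreal (gdist x x0 powr p) \<partial>G) < \<infinity>"
    using G by (auto simp: Pstar_def)
  interpret G: prob_space G by fact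
  have [measurable]: "log_embed \<in> borel_measurable G" by measurable
  let ?M = "\<integral>\<^sup>+ x. ennreal (norm (log_embed x) powr p) \<partial>G"
  \<comment> \<open>The base point has logarithm 0, so the moment assumption about it is a moment of
    \<open>log_embed\<close> about the origin.\<close>
  have "gdist x (0, mat 1) = norm (log_embed x)" for x :: "(real^'d) \<times> (real^'d^'d)"
    by (simp add: gdist_def mlog_mat_1 log_embed_def norm_Pair)
  then have M: "?M < \<infinity>" using fin[of "(0, mat 1)"] mat_1_SPD by simp
  define m where "m = enn2real ?M powr (1 / p)"
  have "moment_measure (distr G borel log_embed) p m"
  proof (intro moment_measure.intro moment_measure_axioms.intro)
    show "prob_space (distr G borel log_embed)" by (rule G.prob_space_distr) simp
    have "(\<integral>\<^sup>+ y. ennreal (norm y powr p) \<partial>distr G borel log_embed) = ?M"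
      by (subst nn_integral_distr) auto
    also have "\<dots> = ennreal (m powr p)"
      using M p by (simp add: m_def powr_powr)
    finally show "(\<integral>\<^sup>+ y. ennreal (norm y powr p) \<partial>distr G borel log_embed) \<le> ennreal (m powr p)" by simp
  qed (use p in \<open>auto simp: m_def\<close>)
  then show thesis by (rule that)
qed

text \<open>\<open>mlog\<close> collapses everything outside \<open>SPD\<close> to 0, so
  \<open>mexp\<close> undoes it only on \<open>SPD\<close>; membership in \<open>Pstar\<close> makes
  that almost every point.\<close>

lemma distr_log_embed_inj:
  fixes G1 G2 :: "((real^'d) \<times> (real^'d^'d)) measure"
  assumes G: "G1 \<in> Pstar p" "G2 \<in> Pstar p"
    and eq: "distr G1 borel log_embed = distr G2 borel log_embed"
  shows "G1 = G2"
proof -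
  let ?inv = "\<lambda>y :: (real^'d) \<times> (real^'d^'d). (fst y, mexp (snd y))"
  have inv: "?inv \<in> borel_measurable borel"
    unfolding borel_prod[symmetric] by measurable
  have *: "distr (distr G borel log_embed) borel ?inv = G" if "G \<in> Pstar p" for G
  proof -
    have sG [measurable_cong]: "sets G = sets borel" and S: "AE x in G. snd x \<in> SPD"
      using that by (auto simp: Pstar_def)
    have [measurable]: "log_embed \<in> borel_measurable G" by measurable
    have "distr (distr G borel log_embed) borel ?inv = distr G borel (?inv \<circ> log_embed)"
      by (rule distr_distr[OF inv]) simp
    also have "\<dots> = distr G borel (\<lambda>x. x)"
    proof (rule distr_cong_AE)
      show "AE x in G. (?inv \<circ> log_embed) x = x"
        using S by eventually_elim (simp add: log_embed_def mexp_mlog)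
      show "?inv \<circ> log_embed \<in> borel_measurable G" by (rule measurable_comp[OF _ inv]) simp
      show "(\<lambda>x. x) \<in> borel_measurable G" by (rule measurable_ident_sets[OF sG])
    qed auto
    also have "\<dots> = G" by (rule distr_id2) (simp add: sG)
    finally show ?thesis .
  qed
  show ?thesis by (rule trans[OF *[OF G(1), unfolded eq, symmetric] *[OF G(2)]])
qed

text \<open>Polar coordinates: \<open>w\<close> records the norms of the two blocks,
  \<open>v\<close> and \<open>A\<close> their directions. Every nonzero pair with symmetric matrix
  part is thus a positive multiple of a direction in the support.\<close>

lemma symmetric_scaled_unif_mix:
  fixes a :: "real^'d" and S :: "real^'d^'d"
  assumes S: "sym_part S = S" and ne: "(a, S) \<noteq> 0"
  obtains w v A where "w \<noteq> 0" "v \<noteq> 0" "sym_part A \<noteq> (0 :: real^'d^'d)"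
    "norm w *\<^sub>R mix_dir (sgn w, sgn v, sgn (sym_part A)) = (a, S)"
proof -
  define w :: "real^2" where "w = vector [norm a, norm S]"
  \<comment> \<open>A zero block has weight 0 in \<open>w\<close>, so any nonzero direction serves;
    the same holds for \<open>mat 1\<close> in \<open>A\<close>.\<close>
  define v where "v = (if a = 0 then 1 else a)"
  define A where "A = (if S = 0 then mat 1 else S)"
  have w: "w $ 1 = norm a" "w $ 2 = norm S" by (simp_all add: w_def)
  have w0: "w \<noteq> 0" using ne w by (auto simp: zero_prod_def vec_eq_iff forall_2)
  have sgn_w: "norm w * sgn w $ i = w $ i" for i using w0 by (simp add: sgn_div_norm)
  have v: "norm a *\<^sub>R sgn v = a" by (simp add: v_def sgn_div_norm)
  have A: "norm S *\<^sub>R sgn (sym_part A) = S" by (simp add: A_def sgn_div_norm S)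
  have "sym_part (mat 1 :: real^'d^'d) = mat 1"
    by (simp add: sym_part_def vec_eq_iff mat_def transpose_def)
  moreover have "(mat 1 :: real^'d^'d) \<noteq> 0" by (simp add: vec_eq_iff mat_def)
  ultimately have "sym_part A \<noteq> 0" by (simp add: A_def S)
  moreover have "v \<noteq> 0" by (simp add: v_def)
  moreover have "norm w *\<^sub>R mix_dir (sgn w, sgn v, sgn (sym_part A)) = (a, S)"
    using v A w by (simp add: mix_dir_def sgn_w)
  ultimately show thesis using w0 that by blast
qed

text \<open>The hypothesis may fail on a null set of directions, which could contain the one wanted.
  Continuity excludes this: a nonzero difference there would persist on an open set of directions,
  and such a set has positive mass.\<close>

lemma char_eq_from_slices:
  fixes G1 G2 :: "((real^'d) \<times> (real^'d^'d)) measure"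
  assumes G: "prob_space G1" "sets G1 = sets borel" "prob_space G2" "sets G2 = sets borel"
    and ae: "AE z in unif_mix. \<forall>t. (CLINT x|G1. iexp ((t *\<^sub>R mix_dir z) \<bullet> log_embed x)) = (CLINT x|G2. iexp ((t *\<^sub>R mix_dir z) \<bullet> log_embed x))"
  shows "(CLINT x|G1. iexp (u \<bullet> log_embed x)) = (CLINT x|G2. iexp (u \<bullet> log_embed x))"
proof -
  note [measurable_cong] = G(2,4)
  define F where "F u = (CLINT x|G1. iexp (u \<bullet> log_embed x)) - (CLINT x|G2. iexp (u \<bullet> log_embed x))" for u
  have contF: "continuous_on UNIV F"
    unfolding F_def by (intro continuous_intros continuous_on_char G) measurable
  define a where "a = fst u"
  \<comment> \<open>Pairing with the symmetric matrix \<open>mlog\<close> annihilates the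
    antisymmetric part of \<open>snd u\<close>.\<close>
  define S where "S = sym_part (snd u)"
  have SS: "sym_part S = S" by (simp add: S_def sym_part_def transpose_def vec_eq_iff field_simps)
  have "u \<bullet> log_embed x = (a, S) \<bullet> log_embed x" for x
  proof -
    have "transpose (snd u) \<bullet> mlog (snd x) = snd u \<bullet> mlog (snd x)"
      by (simp add: inner_transpose mlog_symmetric)
    then show ?thesis
      by (simp add: log_embed_def a_def S_def sym_part_def inner_prod_def inner_add_left)
  qed
  then have Fu: "F u = F (a, S)" by (simp add: F_def)
  have "F (a, S) = 0"
  proof (cases "(a, S) = 0")
    case True
    interpret G1: prob_space G1 by (rule G)
    interpret G2: prob_space G2 by (rule G)
    show ?thesis unfolding True by (simp add: F_def G1.prob_space G2.prob_space)
  next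
    case False
    obtain w v A where wvA: "w \<noteq> 0" "v \<noteq> 0" "sym_part A \<noteq> (0 :: real^'d^'d)"
      "norm w *\<^sub>R mix_dir (sgn w, sgn v, sgn (sym_part A)) = (a, S)"
      using symmetric_scaled_unif_mix[OF SS False] by blast
    show ?thesis
    proof (rule ccontr)
      assume "F (a, S) \<noteq> 0"
      \<comment> \<open>The radius is frozen at \<open>norm w\<close> and only the direction varies,
        so \<open>T\<close> is an open set of directions to which the hypothesis with
        \<open>t = norm w\<close> applies.\<close>
      define T where "T = {z. F (norm w *\<^sub>R mix_dir z) \<noteq> 0}"
      have "open T" unfolding T_def
        by (intro open_Collect_neq continuous_intros continuous_on_compose2[OF contF] continuous_on_mix_dir) auto
      moreover have "(sgn w, sgn v, sgn (sym_part A)) \<in> T"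
        using \<open>F (a, S) \<noteq> 0\<close> wvA(4) by (simp add: T_def)
      ultimately have pos: "emeasure unif_mix T > 0" using wvA by (intro unif_mix_open_pos)
      have "AE z in unif_mix. z \<notin> T"
        using ae by eventually_elim (simp add: T_def F_def)
      moreover have "T \<in> sets unif_mix" using \<open>open T\<close> by (simp add: sets_unif_mix)
      ultimately have "emeasure unif_mix T = 0"
        by (subst (asm) AE_iff_measurable[OF _ refl]) (auto simp: Collect_conj_eq Int_absorb1 dest: sets.sets_into_space)
      with pos show False by simp
    qed
  qed
  with Fu show ?thesis by (simp add: F_def)
qed

lemma mixSW_pp_eq:
  fixes G1 G2 :: "((real^'d) \<times> (real^'d^'d)) measure"
  assumes "sets G1 = sets borel" "sets G2 = sets borel"
  shows "mixSW_pp p G1 G2 = (\<integral>\<^sup>+ z. wass_pp p (slice (distr G1 borel log_embed) (mix_dir z))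
    (slice (distr G2 borel log_embed) (mix_dir z)) \<partial>unif_mix)"
proof -
  have "distr G borel (\<lambda>x. mix_dir z \<bullet> log_embed x) = slice (distr G borel log_embed) (mix_dir z)"
    if [measurable_cong]: "sets G = sets borel" for G :: "((real^'d) \<times> (real^'d^'d)) measure" and z
    by (subst distr_distr) (auto simp: comp_def)
  then show ?thesis using assms unfolding mixSW_pp_def proj_mix_eq_inner by simp
qed

section \<open>Finiteness, separation and the triangle inequality on \<open>Pstar\<close>\<close>

context
  fixes G1 G2 :: "((real^'d) \<times> (real^'d^'d)) measure" and p :: real
  assumes G: "G1 \<in> Pstar p" "G2 \<in> Pstar p" and p: "p \<ge> 1"
begin

abbreviation (input) "slice_dist z \<equiv> wass p (slice (distr G1 borel log_embed) (mix_dir z))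
    (slice (distr G2 borel log_embed) (mix_dir z))"

lemma sets_G: "sets G1 = sets borel" "sets G2 = sets borel"
  and prob_G: "prob_space G1" "prob_space G2"
  using G by (auto simp: Pstar_def)

lemma obtain_moments:
  obtains m n where "moment_measure2 (distr G1 borel log_embed) (distr G2 borel log_embed) p m n"
proof -
  obtain m where "moment_measure (distr G1 borel log_embed) p m"
    by (rule Pstar_moment[OF G(1) p])
  moreover obtain n where "moment_measure (distr G2 borel log_embed) p n"
    by (rule Pstar_moment[OF G(2) p])
  ultimately show thesis by (intro that[of m n] moment_measure2.intro)
qed

text \<open>Used in Minkowski's inequality over the directions and in passing from a zero integral
  to slices that agree almost everywhere.\<close>

lemma measurable_slice_dist: "slice_dist \<in> borel_measurable unif_mix"
proof -
  obtain m n where "moment_measure2 (distr G1 borel log_embed) (distr G2 borel log_embed) p m n"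
    by (rule obtain_moments)
  then interpret moment_measure2 "distr G1 borel log_embed" "distr G2 borel log_embed" p m n .
  have "continuous_on UNIV slice_dist"
    by (rule continuous_on_compose2[OF continuous_wass_slices[of UNIV] continuous_on_mix_dir]) simp
  then have "slice_dist \<in> borel_measurable borel" by (rule borel_measurable_continuous_onI)
  then show ?thesis by (simp add: measurable_cong_sets[OF sets_unif_mix refl])
qed

lemma mixSW_pp_slice_dist: "mixSW_pp p G1 G2 = (\<integral>\<^sup>+ z. ennreal (slice_dist z powr p) \<partial>unif_mix)"
proof -
  obtain m n where "moment_measure2 (distr G1 borel log_embed) (distr G2 borel log_embed) p m n"
    by (rule obtain_moments)
  then interpret moment_measure2 "distr G1 borel log_embed" "distr G2 borel log_embed" p m n .
  show ?thesis
    unfolding mixSW_pp_eq[OF sets_G] by (simp only: wass_pp_eq[OF p wass_pp_slices_finite])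
qed

text \<open>Slice distances are at most \<open>(m + n)\<close> times the norm of the direction,
  hence bounded. This rules out that \<open>enn2real\<close> reports distance 0 for an infinite
  integral.\<close>

lemma mixSW_pp_finite: "mixSW_pp p G1 G2 < \<infinity>"
proof -
  obtain m n where "moment_measure2 (distr G1 borel log_embed) (distr G2 borel log_embed) p m n"
    by (rule obtain_moments)
  then interpret moment_measure2 "distr G1 borel log_embed" "distr G2 borel log_embed" p m n .
  interpret U: prob_space "unif_mix :: 'd mix measure" by (rule prob_space_unif_mix)
  have "(\<integral>\<^sup>+ z. ennreal (slice_dist z powr p) \<partial>unif_mix) \<le> (\<integral>\<^sup>+ z. ennreal ((m + n) powr p) \<partial>(unif_mix :: 'd mix measure))"
  proof (rule nn_integral_mono_AE)
    show "AE z in unif_mix. ennreal (slice_dist z powr p) \<le> ennreal ((m + n) powr p)"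
      using unif_mix_norm_le
    proof eventually_elim
      case (elim z)
      have "slice_dist z \<le> norm (mix_dir z) * (m + n)" by (rule wass_slices_le)
      also have "\<dots> \<le> 1 * (m + n)" using elim H.m K.m by (intro mult_right_mono) auto
      finally show ?case using p by (intro ennreal_leI powr_mono2) auto
    qed
  qed
  also have "\<dots> < \<infinity>" by (simp add: U.emeasure_space_1)
  finally show ?thesis unfolding mixSW_pp_slice_dist .
qed

lemma mixSW_pp_powr: "mixSW_pp p G1 G2 = ennreal (mixSW p G1 G2 powr p)"
  using mixSW_pp_finite p by (simp add: mixSW_def powr_powr)

lemma mixSW_eq_0_imp_eq:
  assumes "mixSW p G1 G2 = 0"
  shows "G1 = G2"
proof (rule distr_log_embed_inj[OF G])
  note [measurable_cong] = sets_G
  have [measurable]: "log_embed \<in> borel_measurable G1" "log_embed \<in> borel_measurable G2" by measurable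
  let ?H = "\<lambda>G. distr G borel log_embed"
  obtain m n where "moment_measure2 (?H G1) (?H G2) p m n"
    by (rule obtain_moments)
  then interpret moment_measure2 "?H G1" "?H G2" p m n .
  have "(\<integral>\<^sup>+ z. ennreal (slice_dist z powr p) \<partial>unif_mix) = 0"
    using assms mixSW_pp_powr unfolding mixSW_pp_slice_dist by simp
  then have "AE z in unif_mix. ennreal (slice_dist z powr p) = 0"
    using measurable_slice_dist by (subst (asm) nn_integral_0_iff_AE) auto
  then have ae: "AE z in unif_mix. \<forall>t. (CLINT x|G1. iexp ((t *\<^sub>R mix_dir z) \<bullet> log_embed x)) = (CLINT x|G2. iexp ((t *\<^sub>R mix_dir z) \<bullet> log_embed x))"
  proof eventually_elim
    case (elim z)
    then have "slice_dist z = 0" by (simp add: powr_def split: if_splits)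
    then have "wass_pp p (slice (?H G1) (mix_dir z)) (slice (?H G2) (mix_dir z)) = 0"
      using wass_pp_eq[OF p wass_pp_slices_finite] by simp
    from wass_pp_0_imp_char_eq[OF p H.prob_slice this]
    have "char (slice (?H G1) (mix_dir z)) t = char (slice (?H G2) (mix_dir z)) t" for t .
    \<comment> \<open>Cramer-Wold: the characteristic function of a slice at \<open>t\<close> is the
      multivariate one at \<open>t\<close> times the direction.\<close>
    moreover have "char (slice (?H G) (mix_dir z)) t = (CLINT x|G. iexp ((t *\<^sub>R mix_dir z) \<bullet> log_embed x))"
      if [measurable_cong]: "sets G = sets borel" for G :: "((real^'d) \<times> (real^'d^'d)) measure" and t
      unfolding char_def by (subst integral_distr, simp, simp, subst integral_distr) simp_all
    ultimately show ?case using sets_G by metis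
  qed
  show "?H G1 = ?H G2"
  proof (rule char_uniqueness)
    show "(CLINT x|?H G1. iexp (u \<bullet> x)) = (CLINT x|?H G2. iexp (u \<bullet> x))" for u
      using char_eq_from_slices[OF prob_G(1) sets_G(1) prob_G(2) sets_G(2) ae, of u]
      by (subst (1 2) integral_distr) simp_all
  qed (use H.prob_space_axioms K.prob_space_axioms in auto)
qed

end

lemma mixSW_commute: "mixSW p G1 G2 = mixSW p G2 G1"
proof -
  have "mixSW_pp p G1 G2 = mixSW_pp p G2 G1"
    unfolding mixSW_pp_def by (intro nn_integral_cong wass_pp_commute)
  then show ?thesis by (simp add: mixSW_def)
qed

lemma mixSW_self:
  assumes "G \<in> Pstar p"
  shows "mixSW p G G = 0"
proof -
  have "sets G = sets borel" using assms by (simp add: Pstar_def)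
  then have "mixSW_pp p G G = 0"
    by (simp add: mixSW_pp_eq wass_pp_self)
  then show ?thesis by (simp add: mixSW_def)
qed

lemma mixSW_triangle:
  fixes G1 G2 G3 :: "((real^'d) \<times> (real^'d^'d)) measure"
  assumes G: "G1 \<in> Pstar p" "G2 \<in> Pstar p" "G3 \<in> Pstar p" and p: "p \<ge> 1"
  shows "mixSW p G1 G3 \<le> mixSW p G1 G2 + mixSW p G2 G3"
proof (rule field_le_epsilon)
  fix e :: real assume e: "e > 0"
  let ?s = "\<lambda>G z. slice (distr G borel log_embed) (mix_dir z)"
  let ?d = "\<lambda>G G' z. wass p (?s G z) (?s G' z)"
  obtain m1 m2 where "moment_measure2 (distr G1 borel log_embed) (distr G2 borel log_embed) p m1 m2"
    by (rule obtain_moments[OF G(1,2) p])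
  then interpret H12: moment_measure2 "distr G1 borel log_embed" "distr G2 borel log_embed" p m1 m2 .
  obtain m2' m3 where "moment_measure2 (distr G2 borel log_embed) (distr G3 borel log_embed) p m2' m3"
    by (rule obtain_moments[OF G(2,3) p])
  then interpret H23: moment_measure2 "distr G2 borel log_embed" "distr G3 borel log_embed" p m2' m3 .
  \<comment> \<open>Enlarging by \<open>e / 2\<close> keeps the bounds positive, as Minkowski
    requires, even when a distance is 0.\<close>
  have bound: "(\<integral>\<^sup>+ z. ennreal (?d G G' z powr p) \<partial>unif_mix) \<le> ennreal ((mixSW p G G' + e / 2) powr p)"
    if "G \<in> Pstar p" "G' \<in> Pstar p" for G G'
  proof -
    have "mixSW_pp p G G' \<le> ennreal ((mixSW p G G' + e / 2) powr p)"
      unfolding mixSW_pp_powr[OF that p] using e p by (intro ennreal_leI powr_mono2) (auto simp: mixSW_def)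
    then show ?thesis unfolding mixSW_pp_slice_dist[OF that p] .
  qed
  have pos: "0 < mixSW p G G' + e / 2" for G G' :: "((real^'d) \<times> (real^'d^'d)) measure"
    using e by (simp add: mixSW_def add_nonneg_pos)
  have "mixSW_pp p G1 G3 = (\<integral>\<^sup>+ z. ennreal (?d G1 G3 z powr p) \<partial>unif_mix)"
    by (rule mixSW_pp_slice_dist[OF G(1,3) p])
  also have "\<dots> \<le> (\<integral>\<^sup>+ z. ennreal ((?d G1 G2 z + ?d G2 G3 z) powr p) \<partial>unif_mix)"
    using p by (intro nn_integral_mono ennreal_leI powr_mono2 wass_triangle H12.K.prob_slice
        H12.wass_pp_slices_finite H23.wass_pp_slices_finite) auto
  also have "\<dots> \<le> ennreal (((mixSW p G1 G2 + e / 2) + (mixSW p G2 G3 + e / 2)) powr p)"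
    by (intro nn_integral_Minkowski measurable_slice_dist wass_nonneg pos bound G p)
  finally have "enn2real (mixSW_pp p G1 G3) \<le> ((mixSW p G1 G2 + e / 2) + (mixSW p G2 G3 + e / 2)) powr p"
    by (intro enn2real_leI) auto
  then have "mixSW p G1 G3 \<le> (((mixSW p G1 G2 + e / 2) + (mixSW p G2 G3 + e / 2)) powr p) powr (1 / p)"
    unfolding mixSW_def[of p G1 G3] using p by (intro powr_mono2) auto
  also have "\<dots> = mixSW p G1 G2 + mixSW p G2 G3 + e"
    using p pos[of G1 G2] pos[of G2 G3] by (simp add: powr_powr)
  finally show "mixSW p G1 G3 \<le> mixSW p G1 G2 + mixSW p G2 G3 + e" .
qed

theorem theorem1:
  fixes p :: real
  assumes "p \<ge> 1"
  shows "\<forall>G1 \<in> (Pstar p :: (((real^'d) \<times> (real^'d^'d)) measure) set).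
         \<forall>G2 \<in> Pstar p. \<forall>G3 \<in> Pstar p.
            mixSW_pp p G1 G2 < \<infinity> \<and>
            mixSW p G1 G2 \<ge> 0 \<and>
            mixSW p G1 G2 = mixSW p G2 G1 \<and>
            (mixSW p G1 G2 = 0 \<longleftrightarrow> G1 = G2) \<and>
            mixSW p G1 G3 \<le> mixSW p G1 G2 + mixSW p G2 G3"
proof (intro ballI conjI)
  fix G1 G2 G3 :: "((real^'d) \<times> (real^'d^'d)) measure"
  assume G: "G1 \<in> Pstar p" "G2 \<in> Pstar p" "G3 \<in> Pstar p"
  show "mixSW_pp p G1 G2 < \<infinity>" by (rule mixSW_pp_finite[OF G(1,2) assms])
  show "mixSW p G1 G2 \<ge> 0" by (simp add: mixSW_def)
  show "mixSW p G1 G2 = mixSW p G2 G1" by (rule mixSW_commute)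
  show "mixSW p G1 G2 = 0 \<longleftrightarrow> G1 = G2"
    using mixSW_eq_0_imp_eq[OF G(1,2) assms] mixSW_self[OF G(1)] by blast
  show "mixSW p G1 G3 \<le> mixSW p G1 G2 + mixSW p G2 G3" by (rule mixSW_triangle[OF G assms])
qed

end
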